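(* Let $F$ be the free group of rank two with free basis $A,B$, and let $E_{p/q}\in F$, for $p/q\in\mathbb{Q}\cup\{1/0\}$, be the words defined by the enumeration scheme in the context. Then, up to conjugacy and inverses, the words $E_{p/q}$ enumerate the primitive elements of $F$: every $E_{p/q}$ is primitive, and for every primitive element $W\in F$ there is exactly one $p/q\in\mathbb{Q}\cup\{1/0\}$ such that $W$ is conjugate in $F$ to $E_{p/q}$ or to $E_{p/q}^{-1}$. Moreover: (1) If $pq$ is even, then $E_{p/q}$ is a palindrome; it is cyclically reduced and it is the unique palindrome in its conjugacy class. (2) If $pq$ is odd, let $m/n$ and $r/s$ be the parents of $p/q$, labeled so that $m/n<p/q<r/s$ if $p/q>0$, and $m/n>p/q>r/s$ if $p/q<0$. Then $E_{p/q}=E^{\sigma}_{r/s}E^{\sigma}_{m/n}$, where $\sigma=+$ if $p/q>0$ and $\sigma=-$ if $p/q<0$. Both $E^{\sigma}_{m/n}$ and $E^{\sigma}_{r/s}$ are palindromes (which have already appeared in the scheme), and $E_{p/q}$ is cyclically reduced.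
   Context: An element $W$ of the rank two free group $F$ is primitive if there is $V\in F$ such that $W$ and $V$ generate $F$. A palindrome is an element whose reduced word in $A^{\pm1},B^{\pm1}$ reads the same forwards and backwards. Rationals $p/q$ are written in lowest terms with $q>0$; $1/0$ denotes the point at infinity, regarded as larger than every nonnegative rational in the positive scheme below and (as $-\infty$) as smaller than every nonpositive rational in the negative scheme. Parents. Let $p/q>0$ have continued fraction expansion $[a_0;a_1,\dots,a_k]=a_0+\cfrac{1}{a_1+\cfrac{1}{\ddots+\cfrac{1}{a_k}}}$ with integers $a_0\ge 0$, $a_j>0$ for $1\le j\le k$, and $a_k\ge 2$ if $k\ge1$. The parents of $p/q$ are the two fractions $[a_0;a_1,\dots,a_{k-1}]$ and $[a_0;a_1,\dots,a_{k-1},a_k-1]$, where for $k=0$ the first (empty) expansion is understood as $1/0$ and the second is $(a_0-1)/1$. One parent is smaller than $p/q$ and the other is larger. (They are the two Farey neighbors of $p/q$ whose Farey sum is $p/q$: if $m/n<p/q<r/s$ are the parents, then $p=m+r$, $q=n+s$, and $|ms-nr|=1$.) For $p/q<0$ the parents of $p/q$ are the negatives of the parents of $|p/q|$, with $-1/0$ identified with $1/0$. Enumeration scheme for positive rationals (words $E^{+}_{p/q}$, $p/q\in\mathbb{Q}_{\ge0}\cup\{1/0\}$). Set $E^{+}_{0/1}=A^{-1}$, $E^{+}_{1/0}=B$, $E^{+}_{1/1}=BA^{-1}$. Inductively, for $p/q>0$ with parents $m/n<p/q<r/s$, set $E^{+}_{p/q}=E^{+}_{r/s}E^{+}_{m/n}$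 if $pq$ is odd, and $E^{+}_{p/q}=E^{+}_{m/n}E^{+}_{r/s}$ if $pq$ is even. Enumeration scheme for negative rationals (words $E^{-}_{p/q}$, $p/q\in\mathbb{Q}_{\le0}\cup\{1/0\}$). Set $E^{-}_{0/1}=A$, $E^{-}_{1/0}=B$, $E^{-}_{-1/1}=BA$. Inductively, for $p/q<0$ with parents $m/n>p/q>r/s$, set $E^{-}_{p/q}=E^{-}_{r/s}E^{-}_{m/n}$ if $pq$ is odd, and $E^{-}_{p/q}=E^{-}_{m/n}E^{-}_{r/s}$ if $pq$ is even. Define $E_{p/q}=E^{+}_{p/q}$ for $p/q\in\mathbb{Q}_{\ge0}\cup\{1/0\}$ and $E_{p/q}=E^{-}_{p/q}$ for $p/q<0$ (the two schemes agree at $1/0$, and at $0/1$ up to inversion). *)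

theory Defs
  imports Complex_Main "HOL-Algebra.Generated_Groups"
begin

section \<open>The free group of rank two\<close>

datatype generator = A | B

text \<open>The letter \<open>(g, True)\<close> is the generator \<open>g\<close>, and \<open>(g, False)\<close> is its inverse.\<close>

type_synonym letter = "generator \<times> bool"
type_synonym word = "letter list"

definition inv_letter :: "letter \<Rightarrow> letter" where
  "inv_letter x = (fst x, \<not> snd x)"

definition reduced :: "word \<Rightarrow> bool" where
  "reduced w \<longleftrightarrow> successively (\<lambda>x y. y \<noteq> inv_letter x) w"

fun push :: "letter \<Rightarrow> word \<Rightarrow> word" where
  "push x [] = [x]"
| "push x (y # ys) = (if y = inv_letter x then ys else x # y # ys)"

text \<open>Elements of the free group are the reduced words; for reduced \<open>u\<close> and \<open>v\<close>,
  \<open>foldr push u v\<close> is the free reduction of the concatenation \<open>u @ v\<close>.\<close>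

definition F2 :: "word monoid" where
  "F2 = \<lparr>carrier = {w. reduced w}, monoid.mult = (\<lambda>u v. foldr push u v), one = []\<rparr>"

definition primitive_element :: "word \<Rightarrow> bool" where
  "primitive_element W \<longleftrightarrow>
     W \<in> carrier F2 \<and> (\<exists>V \<in> carrier F2. generate F2 {W, V} = carrier F2)"

definition conjugate_in_F2 :: "word \<Rightarrow> word \<Rightarrow> bool" where
  "conjugate_in_F2 U V \<longleftrightarrow>
     (\<exists>g \<in> carrier F2. V = g \<otimes>\<^bsub>F2\<^esub> U \<otimes>\<^bsub>F2\<^esub> inv\<^bsub>F2\<^esub> g)"

definition palindrome :: "word \<Rightarrow> bool" where
  "palindrome W \<longleftrightarrow> W \<in> carrier F2 \<and> rev W = W"

definition cyclically_reduced :: "word \<Rightarrow> bool" where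
  "cyclically_reduced W \<longleftrightarrow>
     W \<in> carrier F2 \<and> (W \<noteq> [] \<longrightarrow> hd W \<noteq> inv_letter (last W))"

lemma inv_letter_inv_letter [simp]: "inv_letter (inv_letter x) = x"
  by (simp add: inv_letter_def)

lemma inv_letter_neq [simp]: "inv_letter x \<noteq> x" "x \<noteq> inv_letter x"
  by (cases x; simp add: inv_letter_def)+

lemma reduced_Nil [simp]: "reduced []"
  by (simp add: reduced_def)

lemma reduced_Cons:
  "reduced (x # w) \<longleftrightarrow> reduced w \<and> (w = [] \<or> hd w \<noteq> inv_letter x)"
  by (cases w) (auto simp: reduced_def)

lemma reduced_push: "reduced w \<Longrightarrow> reduced (push x w)"
  by (cases w) (auto simp: reduced_Cons)

lemma reduced_foldr_push: "reduced v \<Longrightarrow> reduced (foldr push u v)"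
  by (induction u) (auto intro: reduced_push)

lemma push_push_inv: "reduced w \<Longrightarrow> push x (push (inv_letter x) w) = w"
  by (cases w; cases "tl w") (auto simp: reduced_Cons)

lemma foldr_push_push:
  assumes "reduced w"
  shows "foldr push (push x v) w = push x (foldr push v w)"
proof (cases v)
  case (Cons y ys)
  then show ?thesis
    using push_push_inv[OF reduced_foldr_push[OF assms, of ys], of x] by auto
qed simp

lemma foldr_push_assoc:
  "reduced w \<Longrightarrow> foldr push (foldr push u v) w = foldr push u (foldr push v w)"
  by (induction u) (auto simp: foldr_push_push)

lemma push_reduced_Cons: "reduced (x # w) \<Longrightarrow> push x w = x # w"
  by (cases w) (auto simp: reduced_Cons)

lemma foldr_push_Nil: "reduced u \<Longrightarrow> foldr push u [] = u"
  by (induction u) (auto simp: reduced_Cons intro!: push_reduced_Cons)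

lemma foldr_push_append: "reduced (u @ v) \<Longrightarrow> foldr push u v = u @ v"
  by (induction u) (auto simp: reduced_Cons intro!: push_reduced_Cons)

lemma foldr_push_inverse:
  "reduced w \<Longrightarrow> foldr push (map inv_letter (rev u)) (foldr push u w) = w"
proof (induction u arbitrary: w)
  case (Cons x u)
  then show ?case
    using push_push_inv[OF reduced_foldr_push[OF Cons.prems, of u], of "inv_letter x"]
    by simp
qed simp

lemma F2_simps:
  "carrier F2 = {w. reduced w}" "u \<otimes>\<^bsub>F2\<^esub> v = foldr push u v" "\<one>\<^bsub>F2\<^esub> = []"
  by (simp_all add: F2_def)

lemma group_F2: "group F2"
proof (rule groupI)
  fix u assume u: "u \<in> carrier F2"
  let ?v = "foldr push (map inv_letter (rev u)) []"
  have "?v \<otimes>\<^bsub>F2\<^esub> u = foldr push (map inv_letter (rev u)) (foldr push u [])"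
    using u by (simp add: F2_simps foldr_push_assoc foldr_push_Nil)
  then have "?v \<otimes>\<^bsub>F2\<^esub> u = \<one>\<^bsub>F2\<^esub>"
    by (simp add: F2_simps foldr_push_inverse)
  moreover have "?v \<in> carrier F2"
    by (simp add: F2_simps reduced_foldr_push)
  ultimately show "\<exists>v \<in> carrier F2. v \<otimes>\<^bsub>F2\<^esub> u = \<one>\<^bsub>F2\<^esub>" by blast
qed (auto simp: F2_simps reduced_foldr_push foldr_push_assoc)

text \<open>\<open>F2\<close> is free on \<open>[(A, True)]\<close> and \<open>[(B, True)]\<close>: these generate it, and any choice of
  images in a group extends to a homomorphism.\<close>

lemma F2_inverse: "inv\<^bsub>F2\<^esub> [(g, True)] = [(g, False)]"
  by (rule group.inv_equality[OF group_F2])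
    (auto simp: F2_simps reduced_Cons inv_letter_def)

lemma F2_generated: "generate F2 {[(A, True)], [(B, True)]} = carrier F2"
proof
  show "generate F2 {[(A, True)], [(B, True)]} \<subseteq> carrier F2"
    by (rule group.generate_incl[OF group_F2]) (simp add: F2_simps reduced_Cons)
  have letter: "[x] \<in> generate F2 {[(A, True)], [(B, True)]}" for x
  proof -
    obtain g b where x: "x = (g, b)" by force
    have g: "[(g, True)] \<in> {[(A, True)], [(B, True)]}" by (cases g) auto
    show ?thesis
      using generate.incl[OF g, of F2] generate.inv[OF g, of F2] x
      by (cases b) (auto simp: F2_inverse)
  qed
  show "carrier F2 \<subseteq> generate F2 {[(A, True)], [(B, True)]}"
  proof
    fix w assume "w \<in> carrier F2"
    then have "reduced w" by (simp add: F2_simps)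
    then show "w \<in> generate F2 {[(A, True)], [(B, True)]}"
    proof (induction w)
      case Nil
      then show ?case using generate.one[of F2] by (simp add: F2_simps)
    next
      case (Cons x w)
      then have "w \<in> generate F2 {[(A, True)], [(B, True)]}" by (simp add: reduced_Cons)
      from generate.eng[OF letter[of x] this] push_reduced_Cons[OF Cons.prems]
      show ?case by (simp add: F2_simps)
    qed
  qed
qed

lemma F2_universal:
  assumes "group G" "a \<in> carrier G" "b \<in> carrier G"
  shows "\<exists>h \<in> hom F2 G. h [(A, True)] = a \<and> h [(B, True)] = b"
proof -
  interpret G: group G by fact
  define g where "g x = (case x of A \<Rightarrow> a | B \<Rightarrow> b)" for x
  define ev where "ev x = (if snd x then g (fst x) else inv\<^bsub>G\<^esub> g (fst x))" for x
  define h where "h w = foldr (\<lambda>x y. ev x \<otimes>\<^bsub>G\<^esub> y) w \<one>\<^bsub>G\<^esub>" for w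
  have g: "g x \<in> carrier G" for x using assms by (cases x) (auto simp: g_def)
  then have ev: "ev x \<in> carrier G" for x by (simp add: ev_def)
  have h: "h w \<in> carrier G" for w by (induction w) (auto simp: h_def ev)
  have h_Cons: "h (x # w) = ev x \<otimes>\<^bsub>G\<^esub> h w" for x w by (simp add: h_def)
  have cancel: "ev x \<otimes>\<^bsub>G\<^esub> (ev (inv_letter x) \<otimes>\<^bsub>G\<^esub> y) = y" if "y \<in> carrier G" for x y
    using that g by (simp add: ev_def inv_letter_def G.m_assoc[symmetric])
  have h_push: "h (push x w) = ev x \<otimes>\<^bsub>G\<^esub> h w" for x w
    by (cases w) (auto simp: h_Cons cancel[OF h])
  have "h (foldr push u v) = h u \<otimes>\<^bsub>G\<^esub> h v" for u v
  proof (induction u)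
    case Nil
    then show ?case using h[of v] by (simp add: h_def[of "[]"])
  next
    case (Cons x u)
    then show ?case by (simp add: h_push h_Cons G.m_assoc ev h)
  qed
  then have "h \<in> hom F2 G" by (auto simp: hom_def h F2_simps)
  moreover have "h [(A, True)] = a" "h [(B, True)] = b"
    using assms by (simp_all add: h_def ev_def g_def)
  ultimately show ?thesis by blast
qed

section \<open>Slopes, continued fractions and parents\<close>

datatype slope = Frac rat | Infty

text \<open>\<open>Infty\<close> is 1/0, so the numerator and denominator of \<open>Infty\<close> are 1 and 0;
  \<open>quotient_of\<close> yields lowest terms with positive denominator.\<close>

fun num :: "slope \<Rightarrow> int" where
  "num (Frac r) = fst (quotient_of r)"
| "num Infty = 1"

fun den :: "slope \<Rightarrow> int" where
  "den (Frac r) = snd (quotient_of r)"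
| "den Infty = 0"

fun neg :: "slope \<Rightarrow> slope" where
  "neg (Frac r) = Frac (- r)"
| "neg Infty = Infty"

text \<open>1/0 is the largest element for \<open>less_pos\<close> and the smallest one for \<open>less_neg\<close>.\<close>

fun less_pos :: "slope \<Rightarrow> slope \<Rightarrow> bool" where
  "less_pos (Frac r) (Frac s) \<longleftrightarrow> r < s"
| "less_pos (Frac r) Infty \<longleftrightarrow> True"
| "less_pos Infty y \<longleftrightarrow> False"

fun less_neg :: "slope \<Rightarrow> slope \<Rightarrow> bool" where
  "less_neg (Frac r) (Frac s) \<longleftrightarrow> r < s"
| "less_neg Infty (Frac s) \<longleftrightarrow> True"
| "less_neg x Infty \<longleftrightarrow> False"

text \<open>\<open>cf_val [a\<^sub>0, \<dots>, a\<^sub>k]\<close> is the continued fraction \<open>[a\<^sub>0; a\<^sub>1, \<dots>, a\<^sub>k]\<close>;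
  the empty expansion has value 1/0.\<close>

fun cf_val :: "int list \<Rightarrow> slope" where
  "cf_val [] = Infty"
| "cf_val (a # as) =
     (case cf_val as of Infty \<Rightarrow> Frac (of_int a) | Frac r \<Rightarrow> Frac (of_int a + 1 / r))"

definition proper_cf :: "int list \<Rightarrow> bool" where
  "proper_cf as \<longleftrightarrow> as \<noteq> [] \<and> hd as \<ge> 0 \<and> (\<forall>a \<in> set (tl as). a > 0) \<and>
     (length as \<ge> 2 \<longrightarrow> last as \<ge> 2)"

definition cf_expansion :: "rat \<Rightarrow> int list" where
  "cf_expansion r = (THE as. proper_cf as \<and> cf_val as = Frac r)"

definition parents_of_positive :: "rat \<Rightarrow> slope set" where
  "parents_of_positive r =
     (let as = cf_expansion r
      in {cf_val (butlast as), cf_val (butlast as @ [last as - 1])})"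

definition parents :: "rat \<Rightarrow> slope set" where
  "parents r = (if r > 0 then parents_of_positive r else neg ` parents_of_positive \<bar>r\<bar>)"

text \<open>The labelling of the two parents: in both cases the pair \<open>(u, v)\<close> is \<open>(m/n, r/s)\<close>.\<close>

definition labelled_parents_pos :: "rat \<Rightarrow> slope \<times> slope \<Rightarrow> bool" where
  "labelled_parents_pos r = (\<lambda>(u, v). parents r = {u, v} \<and>
     less_pos u (Frac r) \<and> less_pos (Frac r) v)"

definition labelled_parents_neg :: "rat \<Rightarrow> slope \<times> slope \<Rightarrow> bool" where
  "labelled_parents_neg r = (\<lambda>(u, v). parents r = {u, v} \<and>
     less_neg (Frac r) u \<and> less_neg v (Frac r))"

subsection \<open>Existence and uniqueness of expansions and of labelled parents\<close>

lemma neg_neg [simp]: "neg (neg x) = x"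
  by (cases x) auto

lemma less_neg_iff: "less_neg x y \<longleftrightarrow> less_pos (neg y) (neg x)"
  by (cases x; cases y) auto

lemma cf_val_Cons_neq_Infty [simp]: "cf_val (a # as) \<noteq> Infty"
  by (auto split: slope.splits)

lemma cf_val_ge_1:
  "as \<noteq> [] \<Longrightarrow> \<forall>a \<in> set as. a > 0 \<Longrightarrow> \<exists>r \<ge> 1. cf_val as = Frac r"
proof (induction as)
  case (Cons a as)
  have a: "(of_int a :: rat) \<ge> 1" using Cons.prems by auto
  show ?case
  proof (cases "as = []")
    case False
    with Cons obtain r where "r \<ge> 1" "cf_val as = Frac r" by auto
    with a show ?thesis by (auto intro: add_increasing2)
  qed (use a in auto)
qed simp

lemma cf_val_gt_1:
  assumes "as \<noteq> []" "\<forall>a \<in> set as. a > 0" "last as \<ge> 2"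
  shows "\<exists>r > 1. cf_val as = Frac r"
proof (cases as)
  case (Cons a bs)
  have a: "(of_int a :: rat) \<ge> 1" using assms Cons by auto
  show ?thesis
  proof (cases "bs = []")
    case True
    with assms Cons have "(of_int a :: rat) \<ge> 2" by (metis last.simps of_int_le_iff of_int_numeral)
    with True Cons show ?thesis by simp
  next
    case False
    obtain r where r: "r \<ge> 1" "cf_val bs = Frac r"
      using cf_val_ge_1[OF False] assms Cons by auto
    then have "0 < 1 / r" by simp
    with a have "1 < of_int a + 1 / r" by linarith
    with r Cons show ?thesis by simp
  qed
qed (use assms in simp)

lemma proper_cf_Cons:
  "proper_cf (a # as) \<longleftrightarrow> a \<ge> 0 \<and> (\<forall>b \<in> set as. b > 0) \<and> (as \<noteq> [] \<longrightarrow> last as \<ge> 2)"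
  by (cases as) (auto simp: proper_cf_def)

lemma proper_cf_Cons_val:
  assumes "proper_cf (a # as)" "cf_val (a # as) = Frac r"
  shows "a = \<lfloor>r\<rfloor>" and "as = [] \<Longrightarrow> r = of_int a"
    and "as \<noteq> [] \<Longrightarrow> proper_cf as \<and> r \<noteq> of_int a \<and> cf_val as = Frac (1 / (r - of_int a))"
proof -
  show "as = [] \<Longrightarrow> r = of_int a" using assms by simp
  have *: "a = \<lfloor>r\<rfloor> \<and> proper_cf as \<and> r \<noteq> of_int a \<and> cf_val as = Frac (1 / (r - of_int a))"
    if ne: "as \<noteq> []"
  proof -
    obtain t where t: "t > 1" "cf_val as = Frac t"
      using cf_val_gt_1[OF ne] assms ne by (auto simp: proper_cf_Cons)
    then have r: "r = of_int a + 1 / t" using assms by simp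
    have "0 < 1 / t" "1 / t < 1" using t by auto
    then have "a = \<lfloor>r\<rfloor>" unfolding r by (intro floor_unique[symmetric]) auto
    moreover have "proper_cf as"
      using assms ne by (cases as) (auto simp: proper_cf_Cons split: if_splits)
    ultimately show ?thesis using r t by auto
  qed
  show "a = \<lfloor>r\<rfloor>" using * assms by (cases "as = []") auto
  show "as \<noteq> [] \<Longrightarrow> proper_cf as \<and> r \<noteq> of_int a \<and> cf_val as = Frac (1 / (r - of_int a))"
    using * by blast
qed

lemma proper_cf_unique:
  "proper_cf as \<Longrightarrow> proper_cf bs \<Longrightarrow> cf_val as = cf_val bs \<Longrightarrow> as = bs"
proof (induction as arbitrary: bs)
  case Nil
  then show ?case by (simp add: proper_cf_def)
next
  case (Cons a as)
  then obtain b bs' where bs: "bs = b # bs'" by (cases bs) (auto simp: proper_cf_def)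
  obtain r where r: "cf_val (a # as) = Frac r" "cf_val (b # bs') = Frac r"
    using Cons.prems bs by (metis cf_val_Cons_neq_Infty slope.exhaust)
  note A = proper_cf_Cons_val[OF Cons.prems(1) r(1)]
    and B = proper_cf_Cons_val[OF Cons.prems(2)[unfolded bs] r(2)]
  have ab: "a = b" using A(1) B(1) by simp
  show ?case
    using A(2,3) B(2,3) ab bs Cons.IH[of bs'] by (cases "as = []"; cases "bs' = []") auto
qed

lemma proper_cf_exists_aux:
  fixes p q :: nat
  shows "q > 0 \<Longrightarrow> \<exists>as. proper_cf as \<and> cf_val as = Frac (of_nat p / of_nat q)"
proof (induction q arbitrary: p rule: less_induct)
  case (less q)
  show ?case
  proof (cases "p mod q = 0")
    case True
    then have "(of_nat p :: rat) / of_nat q = of_nat (p div q)"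
      using less.prems by (metis of_nat_eq_0_iff of_nat_mult nonzero_mult_div_cancel_right
          mult.commute less_numeral_extra(3) div_mult_mod_eq add_0_right)
    then show ?thesis
      by (intro exI[of _ "[int (p div q)]"]) (simp add: proper_cf_Cons)
  next
    case False
    define s where "s = p mod q"
    have s: "0 < s" "s < q" using False less.prems by (auto simp: s_def)
    from less.IH[OF s(2,1), of q] obtain as where
      as: "proper_cf as" "cf_val as = Frac (of_nat q / of_nat s)" by blast
    have p: "(of_nat p :: rat) = of_nat (p div q) * of_nat q + of_nat s"
      by (metis s_def div_mult_mod_eq of_nat_add of_nat_mult)
    have val: "cf_val (int (p div q) # as) = Frac (of_nat p / of_nat q)"
      using as s less.prems unfolding p by (simp add: field_simps)
    obtain b bs where b: "as = b # bs" using as(1) by (cases as) (auto simp: proper_cf_def)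
    have "b = \<lfloor>(of_nat q / of_nat s :: rat)\<rfloor>"
      using proper_cf_Cons_val(1) as b by blast
    moreover have "(of_nat q / of_nat s :: rat) > 1" using s by simp
    ultimately have b1: "b \<ge> 1" by (simp add: le_floor_iff)
    have "bs = [] \<Longrightarrow> b \<ge> 2"
    proof -
      assume "bs = []"
      then have "(of_nat q / of_nat s :: rat) = of_int b"
        using as b by simp
      with \<open>(of_nat q / of_nat s :: rat) > 1\<close> show "b \<ge> 2" by simp
    qed
    with b1 as(1) b have "proper_cf (int (p div q) # as)"
      by (auto simp: proper_cf_Cons)
    with val show ?thesis by blast
  qed
qed

lemma proper_cf_ex1:
  assumes "r \<ge> 0"
  shows "\<exists>!as. proper_cf as \<and> cf_val as = Frac r"
proof -
  obtain p q where pq: "quotient_of r = (p, q)" by force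
  then have q: "q > 0" and r: "r = of_int p / of_int q"
    by (simp_all add: quotient_of_denom_pos quotient_of_div)
  then have "p \<ge> 0" using assms by (simp add: zero_le_divide_iff)
  then have "r = of_nat (nat p) / of_nat (nat q)" using q r by simp
  then show ?thesis
    using proper_cf_exists_aux[of "nat q" "nat p"] q proper_cf_unique by auto
qed

lemma cf_expansion:
  assumes "r \<ge> 0"
  shows "proper_cf (cf_expansion r)" "cf_val (cf_expansion r) = Frac r"
  using theI'[OF proper_cf_ex1[OF assms]] unfolding cf_expansion_def by blast+

lemma cf_expansion_eq: "proper_cf as \<Longrightarrow> cf_val as = Frac r \<Longrightarrow> r \<ge> 0 \<Longrightarrow> cf_expansion r = as"
  using cf_expansion[of r] proper_cf_unique by simp

definition level :: "slope \<Rightarrow> nat" where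
  "level x = (case x of Infty \<Rightarrow> 0 | Frac r \<Rightarrow> nat (sum_list (cf_expansion \<bar>r\<bar>)))"

lemma level_neg [simp]: "level (neg x) = level x"
  by (cases x) (auto simp: level_def)

lemma cf_val_merge: "cf_val (bs @ [c, 1]) = cf_val (bs @ [c + 1])"
  by (induction bs) auto

lemma cf_val_nonneg:
  assumes "as \<noteq> []" "hd as \<ge> 0" "\<forall>a \<in> set (tl as). a > 0"
  shows "\<exists>r \<ge> 0. cf_val as = Frac r"
proof (cases as)
  case (Cons a bs)
  show ?thesis
  proof (cases "bs = []")
    case False
    then obtain r where "r \<ge> 1" "cf_val bs = Frac r"
      using cf_val_ge_1[of bs] assms Cons by auto
    then show ?thesis using assms Cons by auto
  qed (use assms Cons in auto)
qed (use assms in simp)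

lemma level_cf_val:
  assumes "as \<noteq> []" "hd as \<ge> 0" "\<forall>a \<in> set (tl as). a > 0"
  shows "level (cf_val as) = nat (sum_list as)"
proof -
  obtain r where r: "r \<ge> 0" "cf_val as = Frac r" using cf_val_nonneg[OF assms] by blast
  show ?thesis
  proof (cases "proper_cf as")
    case True
    then show ?thesis using cf_expansion_eq[OF True r(2,1)] r by (simp add: level_def)
  next
    case False
    then have len: "length as \<ge> 2" "last as < 2" using assms by (auto simp: proper_cf_def)
    obtain cs l where cs: "as = cs @ [l]"
      using assms(1) by (cases as rule: rev_cases) auto
    with len have ne: "cs \<noteq> []" by auto
    with cs obtain bs c where bs: "as = bs @ [c, l]" by (cases cs rule: rev_cases) auto
    have "l > 0" using assms cs ne by (cases cs) auto
    then have l: "l = 1" using len cs by simp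
    have "c \<ge> 0" "bs \<noteq> [] \<Longrightarrow> c > 0" using assms bs by (cases bs; auto)+
    then have "proper_cf (bs @ [c + 1])"
      using assms bs by (cases bs) (auto simp: proper_cf_def)
    moreover have "cf_val (bs @ [c + 1]) = Frac r" using r(2) bs l cf_val_merge by metis
    ultimately have "cf_expansion r = bs @ [c + 1]" using cf_expansion_eq r by blast
    then show ?thesis using r bs l by (simp add: level_def)
  qed
qed

lemma parents_cf_order:
  assumes "proper_cf as" "cf_val as = Frac r" "r > 0"
  shows "let y = cf_val (butlast as); z = cf_val (butlast as @ [last as - 1]) in
    (less_pos y (Frac r) \<and> less_pos (Frac r) z \<or> less_pos z (Frac r) \<and> less_pos (Frac r) y)"
  using assms
proof (induction as arbitrary: r)
  case Nil
  then show ?case by simp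
next
  case (Cons a as)
  show ?case
  proof (cases "as = []")
    case True
    then show ?thesis using Cons.prems by auto
  next
    case False
    note * = proper_cf_Cons_val(3)[OF Cons.prems(1,2) False]
    define t where "t = 1 / (r - of_int a)"
    have as: "\<forall>b \<in> set as. b > 0" "last as \<ge> 2"
      using Cons.prems(1) False by (auto simp: proper_cf_Cons)
    obtain t' where "t' > 1" "cf_val as = Frac t'" using cf_val_gt_1[OF False as] by blast
    then have t: "t > 1" "cf_val as = Frac t" "proper_cf as" using * by (auto simp: t_def)
    have r: "r = of_int a + 1 / t" using * by (simp add: t_def)
    obtain z where z: "z \<ge> 1" "cf_val (butlast as @ [last as - 1]) = Frac z"
      using cf_val_ge_1[of "butlast as @ [last as - 1]"] as
      by (auto dest: in_set_butlastD)
    have IH: "less_pos (cf_val (butlast as)) (Frac t) \<and> t < z \<or>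
        z < t \<and> less_pos (Frac t) (cf_val (butlast as))"
      using Cons.IH[OF t(3,2)] t(1) z by (simp add: Let_def)
    show ?thesis
    proof (cases "butlast as = []")
      case True
      then have "z < t" using IH by simp
      then have "0 < 1 / t" "1 / t < 1 / z" using t z by (auto simp: field_simps)
      then show ?thesis using True False z r by (simp add: Let_def)
    next
      case nb: False
      obtain y where y: "y \<ge> 1" "cf_val (butlast as) = Frac y"
        using cf_val_ge_1[OF nb] as by (auto dest: in_set_butlastD)
      have "(1 / t < 1 / z \<longleftrightarrow> z < t) \<and> (1 / z < 1 / t \<longleftrightarrow> t < z) \<and>
            (1 / t < 1 / y \<longleftrightarrow> y < t) \<and> (1 / y < 1 / t \<longleftrightarrow> t < y)"
        using y z t by (auto simp: field_simps)
      then show ?thesis using IH False y z r by (auto simp: Let_def)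
    qed
  qed
qed

lemma less_pos_antisym: "less_pos x y \<Longrightarrow> \<not> less_pos y x"
  by (cases x; cases y) auto

lemma labelled_parents_pos_unique:
  "labelled_parents_pos r p \<Longrightarrow> labelled_parents_pos r q \<Longrightarrow> p = q"
  by (cases p; cases q) (auto simp: labelled_parents_pos_def doubleton_eq_iff
      dest: less_pos_antisym)

lemma labelled_parents_pos_ex1:
  assumes "r > 0"
  shows "\<exists>!p. labelled_parents_pos r p"
proof -
  define as where "as = cf_expansion r"
  define y z where "y = cf_val (butlast as)" and "z = cf_val (butlast as @ [last as - 1])"
  have P: "parents r = {y, z}"
    using assms by (simp add: parents_def parents_of_positive_def as_def y_def z_def Let_def)
  have "less_pos y (Frac r) \<and> less_pos (Frac r) z \<or> less_pos z (Frac r) \<and> less_pos (Frac r) y"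
    using parents_cf_order[of as r] cf_expansion[of r] assms
    by (simp add: as_def y_def z_def Let_def)
  then have "labelled_parents_pos r (y, z) \<or> labelled_parents_pos r (z, y)"
    using P by (auto simp: labelled_parents_pos_def)
  then show ?thesis using labelled_parents_pos_unique by blast
qed

lemma labelled_parents_neg_iff:
  assumes "r < 0"
  shows "labelled_parents_neg r (u, v) \<longleftrightarrow> labelled_parents_pos (- r) (neg u, neg v)"
proof -
  have neg_image: "neg ` neg ` X = X" for X by (simp add: image_image)
  have "neg ` X = {u, v} \<longleftrightarrow> X = {neg u, neg v}" for X
    using neg_image[of X] by auto
  then show ?thesis
    using assms by (auto simp: labelled_parents_neg_def labelled_parents_pos_def parents_def
        less_neg_iff)
qed

lemma labelled_parents_neg_ex1:
  assumes "r < 0"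
  shows "\<exists>!p. labelled_parents_neg r p"
proof -
  obtain u v where uv: "labelled_parents_pos (- r) (u, v)"
    using labelled_parents_pos_ex1[of "- r"] assms by auto
  then have "labelled_parents_neg r (neg u, neg v)"
    using assms by (simp add: labelled_parents_neg_iff)
  moreover have "p = (neg u, neg v)" if "labelled_parents_neg r p" for p
    using that uv labelled_parents_neg_iff[OF assms] labelled_parents_pos_unique
    by (cases p) (metis neg_neg prod.inject)
  ultimately show ?thesis by blast
qed

lemma level_parents:
  assumes "r \<noteq> 0" "x \<in> parents r"
  shows "level x < level (Frac r)"
proof -
  define as where "as = cf_expansion \<bar>r\<bar>"
  have as: "proper_cf as" "cf_val as = Frac \<bar>r\<bar>"
    using cf_expansion[of "\<bar>r\<bar>"] by (auto simp: as_def)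
  have lev: "level (Frac r) = nat (sum_list as)" by (simp add: level_def as_def)
  obtain bs l where bs: "as = bs @ [l]"
    using as by (cases as rule: rev_cases) (auto simp: proper_cf_def)
  have l: "l > 0"
    using as assms(1) bs by (cases bs) (auto simp: proper_cf_def)
  have bs0: "\<forall>b \<in> set bs. b \<ge> 0" using as(1) bs by (cases bs) (auto simp: proper_cf_def)
  then have s: "sum_list bs \<ge> 0" by (simp add: sum_list_nonneg)
  have 1: "level (cf_val bs) < level (Frac r)"
  proof (cases "bs = []")
    case True
    then show ?thesis using lev l bs by (simp add: level_def)
  next
    case False
    then have "level (cf_val bs) = nat (sum_list bs)"
      using as(1) bs by (intro level_cf_val) (auto simp: proper_cf_def)
    then show ?thesis using lev bs l s by simp
  qed
  have "level (cf_val (bs @ [l - 1])) = nat (sum_list (bs @ [l - 1]))"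
    using as(1) bs l by (intro level_cf_val; cases bs) (auto simp: proper_cf_def)
  then have 2: "level (cf_val (bs @ [l - 1])) < level (Frac r)"
    using lev bs l s by simp
  have "x \<in> {cf_val bs, cf_val (bs @ [l - 1])} \<or> neg x \<in> {cf_val bs, cf_val (bs @ [l - 1])}"
  proof -
    have P: "parents_of_positive \<bar>r\<bar> = {cf_val bs, cf_val (bs @ [l - 1])}"
      using bs by (simp add: parents_of_positive_def as_def[symmetric])
    have "parents r = parents_of_positive \<bar>r\<bar> \<or> parents r = neg ` parents_of_positive \<bar>r\<bar>"
      by (simp add: parents_def)
    then show ?thesis using assms(2) unfolding P by auto
  qed
  then show ?thesis using 1 2 level_neg[of x] by (metis empty_iff insert_iff)
qed

lemma level_labelled_parents_pos:
  assumes "r > 0" "(u, v) = (THE p. labelled_parents_pos r p)"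
  shows "level u < level (Frac r)" "level v < level (Frac r)"
proof -
  have "labelled_parents_pos r (u, v)"
    unfolding assms(2) by (rule theI'[OF labelled_parents_pos_ex1[OF assms(1)]])
  then have "u \<in> parents r" "v \<in> parents r" by (auto simp: labelled_parents_pos_def)
  then show "level u < level (Frac r)" "level v < level (Frac r)"
    using level_parents assms(1) by auto
qed

lemma level_labelled_parents_neg:
  assumes "r < 0" "(u, v) = (THE p. labelled_parents_neg r p)"
  shows "level u < level (Frac r)" "level v < level (Frac r)"
proof -
  have "labelled_parents_neg r (u, v)"
    unfolding assms(2) by (rule theI'[OF labelled_parents_neg_ex1[OF assms(1)]])
  then have "u \<in> parents r" "v \<in> parents r" by (auto simp: labelled_parents_neg_def)
  then show "level u < level (Frac r)" "level v < level (Frac r)"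
    using level_parents assms(1) by auto
qed

section \<open>The enumeration schemes\<close>

text \<open>\<open>E_pos\<close> is only meant for slopes in \<open>\<rat>\<^sub>\<ge>\<^sub>0 \<union> {1/0}\<close>, and \<open>E_neg\<close> only for slopes in
  \<open>\<rat>\<^sub>\<le>\<^sub>0 \<union> {1/0}\<close>.\<close>

function E_pos :: "slope \<Rightarrow> word" where
  "E_pos Infty = [(B, True)]"
| "E_pos (Frac r) =
     (if r < 0 then undefined
      else if r = 0 then [(A, False)]
      else if r = 1 then [(B, True), (A, False)]
      else let (u, v) = (THE p. labelled_parents_pos r p)
           in if odd (num (Frac r) * den (Frac r)) then E_pos v \<otimes>\<^bsub>F2\<^esub> E_pos u
              else E_pos u \<otimes>\<^bsub>F2\<^esub> E_pos v)"
  by pat_completeness auto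
termination
proof (relation "measure level", goal_cases)
  case 1
  then show ?case by simp
next
  case (2 r x u v)
  then show ?case using level_labelled_parents_pos[of r u v] by simp
next
  case (3 r x u v)
  then show ?case using level_labelled_parents_pos[of r u v] by simp
next
  case (4 r x u v)
  then show ?case using level_labelled_parents_pos[of r u v] by simp
next
  case (5 r x u v)
  then show ?case using level_labelled_parents_pos[of r u v] by simp
qed

function E_neg :: "slope \<Rightarrow> word" where
  "E_neg Infty = [(B, True)]"
| "E_neg (Frac r) =
     (if r > 0 then undefined
      else if r = 0 then [(A, True)]
      else if r = - 1 then [(B, True), (A, True)]
      else let (u, v) = (THE p. labelled_parents_neg r p)
           in if odd (num (Frac r) * den (Frac r)) then E_neg v \<otimes>\<^bsub>F2\<^esub> E_neg u
              else E_neg u \<otimes>\<^bsub>F2\<^esub> E_neg v)"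
  by pat_completeness auto
termination
proof (relation "measure level", goal_cases)
  case 1
  then show ?case by simp
next
  case (2 r x u v)
  then show ?case using level_labelled_parents_neg[of r u v] by simp
next
  case (3 r x u v)
  then show ?case using level_labelled_parents_neg[of r u v] by simp
next
  case (4 r x u v)
  then show ?case using level_labelled_parents_neg[of r u v] by simp
next
  case (5 r x u v)
  then show ?case using level_labelled_parents_neg[of r u v] by simp
qed

definition E :: "slope \<Rightarrow> word" where
  "E x = (case x of Infty \<Rightarrow> E_pos Infty | Frac r \<Rightarrow> if r \<ge> 0 then E_pos x else E_neg x)"

end

(*
  Primitivity is the statement that a generating pair (X, Y) can be chosen through W, and a
  generating pair of the free group of rank two is Nielsen equivalent to (A, B): if no Nielsen
  move, possibly followed by a conjugation, shortens (X, Y), then in a reduced word in X, Y at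
  least one letter of each factor survives free reduction, so A and B can only be written as
  products of length one. Up to a simultaneous conjugation, inversions and a swap, the moves
  (L, R) -> (L R, R), (L, L R) starting from (A, B) or (A^-1, B) reach all pairs that Nielsen moves
  reach, and up to conjugation these two moves are the steps of the Farey tree, along which the
  words E are defined. The exponent sums of A and B recover the slope up to sign, which gives
  uniqueness.

  Palindromicity is carried along the tree by the parities: if both words of a Farey pair (L, R)
  have even type, both are palindromes; if one has odd type, the other one and L R are. A
  palindrome of odd length is the only palindrome among its rotations, because the square of the
  rotation relating two of them is trivial and rotations have odd order.
*)
theory Submission
  imports Defs
begin

section \<open>Reduced words, cancellation and conjugacy\<close>

text \<open>The obstacle in the reduction is a factor half of which cancels on each side: no product
  is then shorter, yet the factor can vanish. The usual remedy is a well-ordering of half-words.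
  Since the claim is only up to conjugacy, simultaneous conjugation may be counted as a move, and it
  makes such a pair strictly shorter. The two positive moves have no inverses among themselves.
  Closure under quotients is therefore the real content of the passage from Nielsen moves to
  positive pairs, and it is there that both signs of \<open>A\<close> enter. Continued fractions are
  used only to show that labelled parents form a pair of determinant 1 with the given mediant. Such
  a pair is unique, so everything later is an induction over integer matrices. In the positive
  scheme only the letters of \<open>B\<close> and of the inverse of \<open>A\<close> occur, so its
  products never cancel and lengths are additive.\<close>

interpretation F2: group F2
  by (rule group_F2)

section \<open>Elementary moves on generating pairs\<close>

lemma (in group) inv_cancel_left [simp]:
  "x \<in> carrier G \<Longrightarrow> y \<in> carrier G \<Longrightarrow> inv x \<otimes> (x \<otimes> y) = y"
  "x \<in> carrier G \<Longrightarrow> y \<in> carrier G \<Longrightarrow> x \<otimes> (inv x \<otimes> y) = y"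
  by (simp_all flip: m_assoc)

lemma (in group) generate_eq_carrierI:
  assumes "S \<subseteq> carrier G" "T \<subseteq> generate G S" "generate G T = carrier G"
  shows "generate G S = carrier G"
  using generate_subgroup_incl[OF assms(2) generate_is_subgroup[OF assms(1)]] generate_incl[OF assms(1)]
    assms(3) by blast

lemma (in group) generate_mult_left:
  assumes "x \<in> carrier G" "y \<in> carrier G" "generate G {x, y} = carrier G"
  shows "generate G {x \<otimes> y, y} = carrier G"
proof (rule generate_eq_carrierI[OF _ _ assms(3)])
  have "(x \<otimes> y) \<otimes> inv y \<in> generate G {x \<otimes> y, y}"
    by (intro generate.eng generate.incl generate.inv) auto
  then show "{x, y} \<subseteq> generate G {x \<otimes> y, y}"
    using assms by (auto simp: m_assoc intro: generate.incl)
qed (use assms in auto)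

lemma (in group) generate_mult_right:
  assumes "x \<in> carrier G" "y \<in> carrier G" "generate G {x, y} = carrier G"
  shows "generate G {x, x \<otimes> y} = carrier G"
proof (rule generate_eq_carrierI[OF _ _ assms(3)])
  have "inv x \<otimes> (x \<otimes> y) \<in> generate G {x, x \<otimes> y}"
    by (intro generate.eng generate.incl generate.inv) auto
  then show "{x, y} \<subseteq> generate G {x, x \<otimes> y}"
    using assms by (auto intro: generate.incl)
qed (use assms in auto)

lemma (in group) generate_inv_left:
  assumes "x \<in> carrier G" "y \<in> carrier G" "generate G {x, y} = carrier G"
  shows "generate G {inv x, y} = carrier G"
proof (rule generate_eq_carrierI[OF _ _ assms(3)])
  have "inv (inv x) \<in> generate G {inv x, y}"
    by (intro generate.inv) auto
  then show "{x, y} \<subseteq> generate G {inv x, y}"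
    using assms by (auto intro: generate.incl)
qed (use assms in auto)

text \<open>Conjugation is a surjective endomorphism, so it carries a generating set to a generating
  set.\<close>

lemma (in group) generate_conj:
  assumes "x \<in> carrier G" "y \<in> carrier G" "g \<in> carrier G" "generate G {x, y} = carrier G"
  shows "generate G {g \<otimes> x \<otimes> inv g, g \<otimes> y \<otimes> inv g} = carrier G"
proof -
  let ?c = "\<lambda>z. g \<otimes> z \<otimes> inv g"
  have c: "?c \<in> hom G G"
    using assms(3) by (intro homI) (auto simp: m_assoc)
  interpret c: group_hom G G ?c
    by unfold_locales (rule c)
  have "?c ` carrier G = carrier G"
  proof (intro equalityI subsetI)
    fix z assume "z \<in> carrier G"
    then have "z = ?c (inv g \<otimes> z \<otimes> g)" "inv g \<otimes> z \<otimes> g \<in> carrier G"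
      using assms(3) by (auto simp: m_assoc)
    then show "z \<in> ?c ` carrier G" by blast
  qed (use assms(3) in auto)
  then show ?thesis
    using c.generate_img[of "{x, y}"] assms by simp
qed

section \<open>Formal inverses and cancellation in products\<close>

definition winv :: "word \<Rightarrow> word" where
  "winv w = map inv_letter (rev w)"

lemma winv_simps [simp]:
  "winv [] = []" "winv (x # w) = winv w @ [inv_letter x]" "winv (u @ v) = winv v @ winv u"
  "winv (winv w) = w" "length (winv w) = length w" "winv w = [] \<longleftrightarrow> w = []"
  by (simp_all add: winv_def rev_map o_def)

lemma inv_letter_eq_iff [simp]: "inv_letter x = inv_letter y \<longleftrightarrow> x = y"
  by (metis inv_letter_inv_letter)

lemma reduced_append:
  "reduced (u @ v) \<longleftrightarrow> reduced u \<and> reduced v \<and> (u \<noteq> [] \<longrightarrow> v \<noteq> [] \<longrightarrow> hd v \<noteq> inv_letter (last u))"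
  by (auto simp: reduced_def successively_append_iff)

lemma reduced_winv [simp]: "reduced (winv w) \<longleftrightarrow> reduced w"
proof -
  have "reduced w \<Longrightarrow> reduced (winv w)" for w
  proof (induction w)
    case (Cons x w)
    then show ?case
      by (cases w) (auto simp: reduced_append reduced_Cons)
  qed simp
  from this[of w] this[of "winv w"] show ?thesis by auto
qed

lemma foldr_push_winv: "foldr push (winv w) w = []" if "reduced w"
  using foldr_push_inverse[of "[]" w] that by (simp add: foldr_push_Nil winv_def)

lemma F2_inv: "reduced w \<Longrightarrow> inv\<^bsub>F2\<^esub> w = winv w"
  by (rule F2.inv_equality) (auto simp: F2_simps foldr_push_winv)

lemma F2_mult_append: "reduced (u @ v) \<Longrightarrow> u \<otimes>\<^bsub>F2\<^esub> v = u @ v"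
  by (simp add: F2_simps foldr_push_append)

text \<open>Maximality of the cancelled part \<open>p\<close> is expressed by reducedness of what
  remains. The induction consumes \<open>v\<close> from the front and \<open>u\<close> from the
  back.\<close>

lemma cancellation:
  assumes "reduced u" "reduced v"
  obtains u' p v' where "u = u' @ winv p" "v = p @ v'" "reduced (u' @ v')"
proof -
  have "\<exists>u' p v'. u = u' @ winv p \<and> v = p @ v' \<and> reduced (u' @ v')"
    using assms
  proof (induction v arbitrary: u)
    case Nil
    then show ?case by (intro exI[of _ u] exI[of _ "[]"]) simp
  next
    case (Cons x v)
    show ?case
    proof (cases "u \<noteq> [] \<and> x = inv_letter (last u)")
      case True
      then obtain t where t: "u = t @ [inv_letter x]"
        by (cases u rule: rev_cases) auto
      with Cons.prems have "reduced t" "reduced v"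
        by (auto simp: reduced_append reduced_Cons)
      from Cons.IH[OF this] obtain u' p v' where
        "t = u' @ winv p" "v = p @ v'" "reduced (u' @ v')" by blast
      with t show ?thesis
        by (intro exI[of _ u'] exI[of _ "x # p"] exI[of _ v']) auto
    next
      case False
      with Cons.prems have "reduced (u @ x # v)"
        by (auto simp: reduced_append)
      then have "u = u @ winv [] \<and> x # v = [] @ x # v \<and> reduced (u @ x # v)" by simp
      then show ?thesis by blast
    qed
  qed
  with that show thesis by blast
qed

lemma foldr_push_cancel:
  assumes "reduced (p @ v)" "reduced (u @ v)"
  shows "foldr push (u @ winv p) (p @ v) = u @ v"
proof -
  have v: "reduced v" using assms(1) by (simp add: reduced_append)
  have "foldr push (winv p) (p @ v) = foldr push (winv p) (foldr push p v)"
    using foldr_push_append[OF assms(1)] by simp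
  also have "\<dots> = v"
    using foldr_push_inverse[OF v] by (simp add: winv_def)
  finally show ?thesis
    using foldr_push_append[OF assms(2)] by simp
qed

lemma F2_mult_cancel_last: "reduced (u @ [x]) \<Longrightarrow> (u @ [x]) \<otimes>\<^bsub>F2\<^esub> [inv_letter x] = u"
  using foldr_push_cancel[of "[inv_letter x]" "[]" u]
  by (simp add: F2_simps reduced_append reduced_Cons)

text \<open>The division is exact: \<open>canc u v\<close> letters of \<open>u\<close> cancel against equally many of \<open>v\<close>.\<close>

definition canc :: "word \<Rightarrow> word \<Rightarrow> nat" where
  "canc u v = (length u + length v - length (u \<otimes>\<^bsub>F2\<^esub> v)) div 2"

lemma canc_append:
  assumes "reduced (p @ v)" "reduced (u @ v)"
  shows "canc (u @ winv p) (p @ v) = length p"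
  using foldr_push_cancel[OF assms] by (simp add: canc_def F2_simps)

lemma canc_obtain:
  assumes "reduced u" "reduced v"
  obtains u' p v' where "u = u' @ winv p" "v = p @ v'" "reduced (u' @ v')"
    "canc u v = length p" "u \<otimes>\<^bsub>F2\<^esub> v = u' @ v'"
proof -
  from cancellation[OF assms] obtain u' p v' where
    *: "u = u' @ winv p" "v = p @ v'" "reduced (u' @ v')" .
  show thesis
    using that[OF *] canc_append[of p v' u'] foldr_push_cancel[of p v' u'] * assms(2) by (simp add: F2_simps)
qed

text \<open>If half of \<open>v\<close> cancelled against \<open>v\<close>, letters in mirror
  positions would be inverse to each other. At the middle this means a letter equal to its own
  inverse (odd length) or two adjacent cancelling letters (even length).\<close>

lemma canc_self:
  assumes "reduced v" "v \<noteq> []"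
  shows "2 * canc v v < length v"
proof (rule ccontr)
  assume "\<not> ?thesis"
  moreover obtain u' p v' where *: "v = u' @ winv p" "v = p @ v'" "canc v v = length p"
    using canc_obtain[OF assms(1) assms(1)] by metis
  ultimately have len: "length v \<le> 2 * length p" by simp
  define n where "n = length v"
  \<comment> \<open>The middle index, or the left one of the two middle indices.\<close>
  define j where "j = (n - 1) div 2"
  have n: "n > 0" "length p \<le> n" using assms(2) * n_def by (auto dest: arg_cong[of v _ length])
  have j: "j < length p" "j < n" using len n by (auto simp: j_def n_def[symmetric])
  have "rev v = map inv_letter p @ rev u'"
    using *(1) by (metis winv_def rev_append rev_map rev_rev_ident)
  then have "rev v ! j = map inv_letter p ! j"
    using j by (simp add: nth_append)
  then have "v ! (n - Suc j) = inv_letter (p ! j)"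
    using j by (simp add: rev_nth n_def)
  moreover have "p ! j = v ! j" using *(2) j by (simp add: nth_append)
  ultimately have e: "v ! (n - Suc j) = inv_letter (v ! j)" by simp
  show False
  proof (cases "odd n")
    case True
    then have "n - Suc j = j" by (auto simp: j_def elim!: oddE)
    with e show False by simp
  next
    case False
    then have s: "n - Suc j = Suc j" "Suc j < n" using n using j_def by presburger+
    then have "successively (\<lambda>x y. y \<noteq> inv_letter x) v"
      using assms(1) by (simp add: reduced_def)
    then have "v ! Suc j \<noteq> inv_letter (v ! j)"
      using s by (simp add: successively_conv_nth n_def)
    with e s show False by simp
  qed
qed

section \<open>Exponent sums, the coordinates of the abelianisation\<close>

fun esum :: "generator \<Rightarrow> word \<Rightarrow> int" where
  "esum g [] = 0"
| "esum g (x # w) = (if fst x = g then if snd x then 1 else - 1 else 0) + esum g w"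

lemma esum_append [simp]: "esum g (u @ v) = esum g u + esum g v"
  by (induction u) auto

lemma esum_winv [simp]: "esum g (winv w) = - esum g w"
  by (induction w) (auto simp: inv_letter_def)

lemma esum_mult:
  "esum g (u \<otimes>\<^bsub>F2\<^esub> v) = esum g u + esum g v"
proof -
  have "esum g (push x w) = esum g [x] + esum g w" for x w
    by (cases w) (auto simp: inv_letter_def)
  then have "esum g (foldr push u v) = esum g u + esum g v"
    by (induction u) auto
  then show ?thesis by (simp add: F2_simps)
qed

lemma esum_conj:
  assumes "conjugate_in_F2 U V"
  shows "esum g V = esum g U"
proof -
  obtain h where "reduced h" "V = h \<otimes>\<^bsub>F2\<^esub> U \<otimes>\<^bsub>F2\<^esub> inv\<^bsub>F2\<^esub> h"
    using assms by (auto simp: conjugate_in_F2_def F2_simps(1))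
  then show ?thesis by (simp add: esum_mult F2_inv)
qed

text \<open>All elements generated by \<open>X\<close> have exponent sums proportional to those of \<open>X\<close>.\<close>

lemma generate_singleton_ne:
  assumes "reduced X"
  shows "generate F2 {X, []} \<noteq> carrier F2"
proof
  assume gen: "generate F2 {X, []} = carrier F2"
  have X: "X \<in> carrier F2" "[] \<in> carrier F2" using assms by (auto simp: F2_simps)
  have z: "esum A X * esum B w = esum B X * esum A w" if "w \<in> generate F2 {X, []}" for w
    using that
  proof (induction)
    case (inv h)
    then show ?case using assms by (auto simp: F2_inv)
  next
    case (eng h1 h2)
    then show ?case by (simp add: esum_mult algebra_simps)
  qed (auto simp: F2_simps)
  from z[of "[(A, True)]"] z[of "[(B, True)]"]
  have 0: "esum A X = 0" unfolding gen by (auto simp: F2_simps reduced_Cons)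
  have "esum A w = 0" if "w \<in> generate F2 {X, []}" for w
    using that by (induction) (use 0 assms in \<open>auto simp: F2_simps(3) F2_inv esum_mult\<close>)
  from this[of "[(A, True)]"] show False unfolding gen by (simp add: F2_simps reduced_Cons)
qed

section \<open>Cyclic reduction and conjugacy\<close>

lemma cyclically_reduced_iff:
  "cyclically_reduced w \<longleftrightarrow> reduced (w @ w)"
  by (cases "w = []") (auto simp: cyclically_reduced_def reduced_append F2_simps(1))

lemma cyclically_reduced_rotate1:
  "cyclically_reduced w \<Longrightarrow> cyclically_reduced (rotate1 w)"
  unfolding cyclically_reduced_iff
  by (cases w; cases "tl w") (auto simp: reduced_append reduced_Cons hd_append)

lemma cyclically_reduced_rotate:
  "cyclically_reduced w \<Longrightarrow> cyclically_reduced (rotate k w)"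
  by (induction k) (auto intro: cyclically_reduced_rotate1)

lemma conj_letter_no_cancel:
  assumes "reduced W" "W \<noteq> []" "hd W \<noteq> inv_letter x" "last W \<noteq> x"
  shows "[x] \<otimes>\<^bsub>F2\<^esub> W \<otimes>\<^bsub>F2\<^esub> [inv_letter x] = x # W @ [inv_letter x]"
  using assms F2_mult_append[of "[x]" W] F2_mult_append[of "x # W" "[inv_letter x]"]
  by (auto simp: reduced_append reduced_Cons)

text \<open>Conjugation by one letter lengthens or shortens the conjugator \<open>h\<close>. If
  \<open>h\<close> is empty and the letter cancels against an end of the core, that letter reappears
  at the other end, which rotates the core by one place.\<close>

lemma conj_letter_form:
  assumes "cyclically_reduced U" "W = h @ rotate k U @ winv h" "reduced W"
  shows "\<exists>h k. [x] \<otimes>\<^bsub>F2\<^esub> W \<otimes>\<^bsub>F2\<^esub> [inv_letter x] = h @ rotate k U @ winv h"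
proof (cases "W = []")
  case True
  then have "[x] \<otimes>\<^bsub>F2\<^esub> W \<otimes>\<^bsub>F2\<^esub> [inv_letter x] = [] @ rotate 0 U @ winv []"
    using assms(2) by (simp add: F2_simps)
  then show ?thesis by blast
next
  case False
  let ?V = "rotate k U"
  have cV: "reduced (?V @ ?V)"
    using cyclically_reduced_rotate[OF assms(1)] by (simp add: cyclically_reduced_iff)
  show ?thesis
  proof (cases h)
    case (Cons y h')
    show ?thesis
    proof (cases "y = inv_letter x")
      case True
      have r: "reduced ((h' @ ?V @ winv h') @ [x])"
        using assms(2,3) True Cons by (auto simp: reduced_Cons)
      have "[x] \<otimes>\<^bsub>F2\<^esub> W = (h' @ ?V @ winv h') @ [x]"
        using assms(2) True Cons by (simp add: F2_simps)
      moreover have "\<dots> \<otimes>\<^bsub>F2\<^esub> [inv_letter x] = h' @ ?V @ winv h'"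
        using F2_mult_cancel_last[OF r] .
      ultimately show ?thesis by metis
    next
      case False
      then have "inv_letter y \<noteq> x" by auto
      then have "[x] \<otimes>\<^bsub>F2\<^esub> W \<otimes>\<^bsub>F2\<^esub> [inv_letter x] = (x # h) @ ?V @ winv (x # h)"
        using conj_letter_no_cancel[OF assms(3), of x] assms(2) Cons False by simp
      then show ?thesis by blast
    qed
  next
    case Nil
    then have W: "W = ?V" using assms(2) by simp
    then have ne: "?V \<noteq> []" using False by simp
    consider "hd W = inv_letter x" | "last W = x" | "hd W \<noteq> inv_letter x" "last W \<noteq> x" by blast
    then show ?thesis
    proof cases
      case 1
      then obtain t where t: "W = inv_letter x # t" using False by (cases W) auto
      then have "rotate1 W = t @ [inv_letter x]" by simp
      moreover have "reduced (rotate1 W)"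
        using cyclically_reduced_rotate[OF assms(1), of "Suc k"] W
        by (simp add: cyclically_reduced_def F2_simps)
      ultimately have "[x] \<otimes>\<^bsub>F2\<^esub> W \<otimes>\<^bsub>F2\<^esub> [inv_letter x] = [] @ rotate (Suc k) U @ winv []"
        using t W F2_mult_append[of t "[inv_letter x]"] by (simp add: F2_simps)
      then show ?thesis by blast
    next
      case 2
      then obtain t where t: "W = t @ [x]" using False by (cases W rule: rev_cases) auto
      have r: "reduced (x # t @ [x])"
      proof -
        have "reduced ((t @ [x]) @ t @ [x])" using cV unfolding W[symmetric] t .
        then show ?thesis by (cases t) (auto simp: reduced_append reduced_Cons)
      qed
      then have "[x] \<otimes>\<^bsub>F2\<^esub> W = (x # t) @ [x]" using t F2_mult_append[of "[x]" W] by simp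
      moreover have "\<dots> \<otimes>\<^bsub>F2\<^esub> [inv_letter x] = x # t"
        using F2_mult_cancel_last[of "x # t" x] r by simp
      \<comment> \<open>Moving the last letter to the front is a rotation backwards by one, written
        as a forward rotation.\<close>
      moreover have "x # t = rotate (length W - 1) W"
        using rotate_append[of t "[x]"] t by simp
      ultimately have "[x] \<otimes>\<^bsub>F2\<^esub> W \<otimes>\<^bsub>F2\<^esub> [inv_letter x] = [] @ rotate (length W - 1 + k) U @ winv []"
        using W by (simp add: rotate_rotate)
      then show ?thesis by blast
    next
      case 3
      then have "[x] \<otimes>\<^bsub>F2\<^esub> W \<otimes>\<^bsub>F2\<^esub> [inv_letter x] = [x] @ ?V @ winv [x]"
        using conj_letter_no_cancel[OF assms(3) False] W by simp
      then show ?thesis by blast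
    qed
  qed
qed

lemma conj_form:
  assumes "cyclically_reduced U" "reduced g"
  shows "\<exists>h k. g \<otimes>\<^bsub>F2\<^esub> U \<otimes>\<^bsub>F2\<^esub> inv\<^bsub>F2\<^esub> g = h @ rotate k U @ winv h"
  using assms(2)
proof (induction g)
  case Nil
  have "reduced U" using assms(1) by (simp add: cyclically_reduced_def F2_simps)
  then have "[] \<otimes>\<^bsub>F2\<^esub> U \<otimes>\<^bsub>F2\<^esub> inv\<^bsub>F2\<^esub> [] = [] @ rotate 0 U @ winv []"
    by (simp add: F2_inv F2_simps foldr_push_Nil)
  then show ?case by blast
next
  case (Cons x g)
  have U: "reduced U" using assms(1) by (simp add: cyclically_reduced_def F2_simps)
  have g: "reduced g" using Cons.prems by (simp add: reduced_Cons)
  define W where "W = g \<otimes>\<^bsub>F2\<^esub> U \<otimes>\<^bsub>F2\<^esub> inv\<^bsub>F2\<^esub> g"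
  have W: "reduced W"
    using F2.m_closed[OF F2.m_closed[of g U] F2.inv_closed[of g]] U g by (simp add: W_def F2_simps(1))
  have c: "[x] \<in> carrier F2" "[inv_letter x] \<in> carrier F2" "g \<in> carrier F2" "U \<in> carrier F2"
    using U g by (auto simp: F2_simps reduced_Cons)
  have "x # g = [x] \<otimes>\<^bsub>F2\<^esub> g" "inv\<^bsub>F2\<^esub> [x] = [inv_letter x]"
    using F2_mult_append[of "[x]" g] Cons.prems by (auto simp: F2_inv reduced_Cons)
  then have "(x # g) \<otimes>\<^bsub>F2\<^esub> U \<otimes>\<^bsub>F2\<^esub> inv\<^bsub>F2\<^esub> (x # g) = [x] \<otimes>\<^bsub>F2\<^esub> W \<otimes>\<^bsub>F2\<^esub> [inv_letter x]"
    using c by (simp add: W_def F2.inv_mult_group F2.m_assoc)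
  then show ?case
    using Cons.IH[OF g] conj_letter_form[OF assms(1) _ W] unfolding W_def by metis
qed

text \<open>A nonempty conjugator would give the first and last letters of \<open>V\<close> as
  mutual inverses.\<close>

lemma conj_cyclically_reduced_rotate:
  assumes "cyclically_reduced U" "cyclically_reduced V" "conjugate_in_F2 U V"
  obtains k where "V = rotate k U"
proof -
  obtain h k where V: "V = h @ rotate k U @ winv h"
    using assms(3) conj_form[OF assms(1)] unfolding conjugate_in_F2_def F2_simps(1) by blast
  have "h = []"
    using assms(2) V by (cases h) (auto simp: cyclically_reduced_def)
  with V that show thesis by simp
qed

section \<open>Palindromes and rotations\<close>

lemma palindrome_rotate_eq:
  assumes "odd (length w)" "rev w = w" "rev (rotate k w) = rotate k w"
  shows "rotate k w = w"
proof -
  let ?n = "length w"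
  \<comment> \<open>Reversal turns a rotation by \<open>k\<close> into a rotation by
    \<open>-k\<close>, and both words are fixed by reversal.\<close>
  have "rotate k w = rotate (?n - k mod ?n) w"
    using assms(2,3) rotate_rev[of "?n - k mod ?n" w] rotate_rev[of k w] rev_swap by metis
  then have "rotate k (rotate k w) = rotate (k + (?n - k mod ?n)) w"
    by (simp add: rotate_rotate)
  also have "(k + (?n - k mod ?n)) mod ?n = 0"
    using assms(1) by (metis add_diff_inverse_nat length_pos_if_in_set mod_add_left_eq mod_le_divisor mod_self not_less odd_pos)
  then have "rotate (k + (?n - k mod ?n)) w = w"
    by (simp add: rotate_id)
  finally have 2: "rotate (2 * k) w = w"
    by (simp add: rotate_rotate mult_2)
  have "rotate (2 * k * m) w = w" for m
    by (induction m) (use 2 in \<open>auto simp: rotate_rotate[symmetric]\<close>)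
  \<comment> \<open>For odd \<open>?n\<close> this number is the inverse of 2 modulo
    \<open>?n\<close>, so the even multiple of \<open>k\<close> obtained is congruent to
    \<open>k\<close>.\<close>
  from this[of "(?n + 1) div 2"] have "rotate (k * (?n + 1)) w = w"
    using assms(1) by (auto elim!: oddE simp: algebra_simps)
  then show ?thesis
    using rotate_conv_mod[of "k * (?n + 1)" w] rotate_conv_mod[of k w] by (simp add: distrib_left)
qed

text \<open>The end letters agree, and no letter is its own inverse.\<close>

lemma palindrome_cyclically_reduced:
  assumes "palindrome W"
  shows "cyclically_reduced W"
proof (cases W)
  case (Cons x w)
  then have "last W = hd W" using assms by (metis hd_rev palindrome_def)
  then show ?thesis using assms by (auto simp: palindrome_def cyclically_reduced_def)
qed (simp add: cyclically_reduced_def F2_simps)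

lemma palindrome_conj_unique:
  assumes "palindrome W" "palindrome V" "odd (length V)" "conjugate_in_F2 W V"
  shows "W = V"
proof -
  obtain k where k: "V = rotate k W"
    using conj_cyclically_reduced_rotate assms palindrome_cyclically_reduced by metis
  then show ?thesis
    using palindrome_rotate_eq[of W k] assms by (auto simp: palindrome_def)
qed

section \<open>Nielsen reduction in rank two\<close>

text \<open>Simultaneous conjugation is included as a move in its own right because the reduction of
  doubly half-cancelled pairs uses it. Inversion and multiplication act on the first entry only;
  \<open>swap\<close> provides the rest.\<close>

inductive (in group) nielsen_equiv :: "'a \<Rightarrow> 'a \<Rightarrow> 'a \<Rightarrow> 'a \<Rightarrow> bool" for a b where
  base: "nielsen_equiv a b a b"
| swap: "nielsen_equiv a b x y \<Longrightarrow> nielsen_equiv a b y x"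
| inv: "nielsen_equiv a b x y \<Longrightarrow> nielsen_equiv a b (inv x) y"
| mult: "nielsen_equiv a b x y \<Longrightarrow> nielsen_equiv a b (x \<otimes> y) y"
| conj: "nielsen_equiv a b x y \<Longrightarrow> g \<in> carrier G \<Longrightarrow>
    nielsen_equiv a b (g \<otimes> x \<otimes> inv g) (g \<otimes> y \<otimes> inv g)"

lemma (in group) nielsen_equiv_inv_right:
  "nielsen_equiv a b x y \<Longrightarrow> nielsen_equiv a b x (inv y)"
  by (rule nielsen_equiv.swap[OF nielsen_equiv.inv[OF nielsen_equiv.swap]])

lemma (in group) nielsen_equiv_multD:
  assumes "nielsen_equiv a b (x \<otimes> y) y" "x \<in> carrier G" "y \<in> carrier G"
  shows "nielsen_equiv a b x y"
  using nielsen_equiv_inv_right[OF nielsen_equiv.mult[OF nielsen_equiv_inv_right[OF assms(1)]]] assms(2,3)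
  by (simp add: m_assoc)

text \<open>Conjugating by the inverse of \<open>x\<close> fixes \<open>x\<close> and turns
  \<open>x y\<close> into \<open>y x\<close>, which leaves the left-hand case with the roles
  exchanged.\<close>

lemma (in group) nielsen_equiv_mult_rightD:
  assumes "nielsen_equiv a b x (x \<otimes> y)" "x \<in> carrier G" "y \<in> carrier G"
  shows "nielsen_equiv a b x y"
proof -
  have "nielsen_equiv a b (inv x \<otimes> (x \<otimes> y) \<otimes> inv (inv x)) (inv x \<otimes> x \<otimes> inv (inv x))"
    using nielsen_equiv.conj[OF nielsen_equiv.swap[OF assms(1)], of "inv x"] assms(2) by simp
  then have "nielsen_equiv a b (y \<otimes> x) x"
    using assms(2,3) by (simp add: m_assoc)
  then show ?thesis
    by (rule nielsen_equiv.swap[OF nielsen_equiv_multD[OF _ assms(3,2)]])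
qed

abbreviation nielsen :: "word \<Rightarrow> word \<Rightarrow> bool" where
  "nielsen \<equiv> F2.nielsen_equiv [(A, True)] [(B, True)]"

lemma length_push: "length (push x w) \<le> Suc (length w)"
  by (cases w) auto

lemma length_mult: "length (u \<otimes>\<^bsub>F2\<^esub> v) \<le> length u + length v"
proof -
  have "length (foldr push u v) \<le> length u + length v"
    by (induction u) (auto intro: order_trans[OF length_push])
  then show ?thesis by (simp add: F2_simps)
qed

text \<open>The hypothesis is local: in three consecutive factors, the cancellations on the two
  sides do not use up the middle one. To make it global, the induction records a surviving prefix
  \<open>S\<close> too long to be consumed by any admissible factor placed in front.\<close>

lemma hom_length_mono:
  assumes h: "h \<in> hom F2 F2"
    and canc: "\<And>x y z. y \<noteq> inv_letter x \<Longrightarrow> z \<noteq> inv_letter y \<Longrightarrow>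
      canc (h [x]) (h [y]) + canc (h [y]) (h [z]) < length (h [y])"
    and w: "reduced w"
  shows "length w \<le> length (h w)"
proof -
  have red: "reduced (h w)" if "reduced w" for w
    using hom_in_carrier[OF h, of w] that by (simp add: F2_simps)
  \<comment> \<open>\<open>S\<close> is what survives of the image of the first letter. Cancellation with the image of a
    letter put in front stops strictly inside \<open>S\<close>, so it never reaches \<open>P\<close>.\<close>
  have "\<exists>S P T. h (x # w) = S @ P \<and> h [x] = S @ T \<and> length w \<le> length P \<and>
      (\<forall>y. x \<noteq> inv_letter y \<longrightarrow> canc (h [y]) (h [x]) < length S)"
    if "reduced (x # w)" for x w
    using that
  proof (induction w arbitrary: x)
    case Nil
    \<comment> \<open>The condition on triples needs a third letter; repeating \<open>x\<close> is
      always admissible.\<close>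
    have "canc (h [y]) (h [x]) < length (h [x])" if "x \<noteq> inv_letter y" for y
      using canc[OF that, of x] by simp
    then show ?case by (intro exI[of _ "h [x]"] exI[of _ "[]"]) auto
  next
    case (Cons x w y)
    have xy: "x \<noteq> inv_letter y" and r: "reduced (x # w)"
      using Cons.prems by (auto simp: reduced_Cons)
    from Cons.IH[OF r] obtain S P T where
      S: "h (x # w) = S @ P" "h [x] = S @ T" "length w \<le> length P" and
      c: "canc (h [y]) (h [x]) < length S"
      using xy by blast
    have "reduced (h [y])" "reduced (h [x])"
      using red by (auto simp: reduced_Cons)
    from canc_obtain[OF this] obtain u p v where
      u: "h [y] = u @ winv p" "h [x] = p @ v" "reduced (u @ v)"
      and p: "canc (h [y]) (h [x]) = length p" .
    obtain v' where v': "S = p @ v'" "v = v' @ T"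
      using S(2) u(2) c p by (auto simp: append_eq_append_conv2)
    have ne: "v' \<noteq> []" using c p v' by auto
    have "reduced (S @ P)" using red[OF r] S(1) by simp
    then have r': "reduced (p @ v' @ P)" "reduced (u @ v' @ P)"
      using u(3) v' ne by (auto simp: reduced_append)
    have "h (y # x # w) = h ([y] \<otimes>\<^bsub>F2\<^esub> (x # w))"
      using F2_mult_append[of "[y]" "x # w"] Cons.prems by simp
    also have "\<dots> = h [y] \<otimes>\<^bsub>F2\<^esub> h (x # w)"
      using r by (intro hom_mult[OF h]) (auto simp: F2_simps reduced_Cons)
    also have "\<dots> = u @ v' @ P"
      using foldr_push_cancel[OF r'] S(1) u(1) v'(1) by (simp add: F2_simps)
    finally have "h (y # x # w) = u @ (v' @ P)" .
    moreover have "length (x # w) \<le> length (v' @ P)"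
      using ne S(3) by (cases v') auto
    \<comment> \<open>\<open>u\<close> is \<open>h [y]\<close> without the letters cancelled on its
      right, so this is the condition on the triple \<open>z\<close>, \<open>y\<close>,
      \<open>x\<close>.\<close>
    moreover have "canc (h [z]) (h [y]) < length u" if "y \<noteq> inv_letter z" for z
      using canc[OF that xy] p u(1) by simp
    ultimately show ?case using u(1) by blast
  qed
  note * = this
  show ?thesis
  proof (cases w)
    case (Cons x w')
    with * w obtain S P where S: "h w = S @ P" "length w' \<le> length P"
      and c: "\<And>y. x \<noteq> inv_letter y \<Longrightarrow> canc (h [y]) (h [x]) < length S" by metis
    from c[of x] have "length S > 0" by (cases S) auto
    then have "length w \<le> length (S @ P)" using S(2) Cons by (cases S) auto
    then show ?thesis using S(1) by simp
  qed simp
qed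

text \<open>For a minimal inequivalent pair: if more than half of one factor cancels, replacing the
  other factor by the product shortens the pair. If exactly half of \<open>v\<close> cancels on each
  side, the two halves are split off and conjugation removes one of them from the product
  \<open>u v\<close>.\<close>

lemma canc_less_of_shorter:
  assumes "reduced u" "reduced v" and gen: "generate F2 {u, v} = carrier F2"
    and IH: "\<And>u' v'. reduced u' \<Longrightarrow> reduced v' \<Longrightarrow> generate F2 {u', v'} = carrier F2 \<Longrightarrow>
      length u' + length v' < length u + length v \<Longrightarrow> nielsen u' v'"
    and no: "\<not> nielsen u v"
  shows "2 * canc u v \<le> length u" "2 * canc u v \<le> length v"
    "v \<noteq> [] \<Longrightarrow> \<not> (2 * canc u v = length v \<and> 2 * canc v u = length v)"
proof -
  have uv: "u \<in> carrier F2" "v \<in> carrier F2" using assms by (auto simp: F2_simps)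
  have ruv: "reduced (u \<otimes>\<^bsub>F2\<^esub> v)"
    using F2.m_closed[OF uv] by (simp add: F2_simps(1))
  from canc_obtain[OF assms(1,2)] obtain u' p v' where
    p: "u = u' @ winv p" "v = p @ v'" "reduced (u' @ v')" "canc u v = length p"
      "u \<otimes>\<^bsub>F2\<^esub> v = u' @ v'" .
  show 1: "2 * canc u v \<le> length u"
  proof (rule ccontr)
    assume "\<not> ?thesis"
    then have "length (u \<otimes>\<^bsub>F2\<^esub> v) < length v" unfolding p(4,5) using p(1,2) by simp
    then have "nielsen u (u \<otimes>\<^bsub>F2\<^esub> v)"
      using F2.generate_mult_right[OF uv gen] ruv assms(1) by (intro IH) auto
    with no uv show False by (blast dest: F2.nielsen_equiv_mult_rightD)
  qed
  show "2 * canc u v \<le> length v"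
  proof (rule ccontr)
    assume "\<not> ?thesis"
    then have "length (u \<otimes>\<^bsub>F2\<^esub> v) < length u" unfolding p(4,5) using p(1,2) by simp
    then have "nielsen (u \<otimes>\<^bsub>F2\<^esub> v) v"
      using F2.generate_mult_left[OF uv gen] ruv assms(2) by (intro IH) auto
    with no uv show False by (blast dest: F2.nielsen_equiv_multD)
  qed
  show "\<not> (2 * canc u v = length v \<and> 2 * canc v u = length v)" if ne: "v \<noteq> []"
  proof
    assume eq: "2 * canc u v = length v \<and> 2 * canc v u = length v"
    from canc_obtain[OF assms(2,1)] obtain v'' q u'' where
      q: "v = v'' @ winv q" "u = q @ u''" "canc v u = length q" .
    have len: "length v' = length p" "length q = length p" "length v'' = length p"
      using eq p q by (auto dest: arg_cong[of v _ length])
    have v: "v = p @ winv q" "v' = winv q" using p(2) q(1) len by auto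
    have "length q \<le> length u'" using 1 p(1,4) len by simp
    then obtain t where t: "u' = q @ t"
      using p(1) q(2) by (auto simp: append_eq_append_conv2)
    have uvt: "u \<otimes>\<^bsub>F2\<^esub> v = q @ t @ winv q" "reduced (q @ t @ winv q)"
      using p(3,5) t v(2) by auto
    have c: "q \<in> carrier F2" "t \<in> carrier F2" "p \<in> carrier F2" "reduced q"
      using uvt(2) assms(2) v by (auto simp: F2_simps(1) reduced_append)
    \<comment> \<open>Now \<open>u = q t p\<inverse>\<close> and \<open>v = p q\<inverse>\<close>, so conjugating \<open>(u v, v)\<close> by \<open>q\<inverse>\<close> gives the
      shorter pair \<open>(t, q\<inverse> p)\<close>.\<close>
    define s where "s = inv\<^bsub>F2\<^esub> q \<otimes>\<^bsub>F2\<^esub> p"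
    have s: "s \<in> carrier F2" using c by (simp add: s_def)
    have "q \<otimes>\<^bsub>F2\<^esub> t \<otimes>\<^bsub>F2\<^esub> inv\<^bsub>F2\<^esub> q = u \<otimes>\<^bsub>F2\<^esub> v"
      using uvt F2_mult_append[of q t] F2_mult_append[of "q @ t" "winv q"] c
        reduced_append[of "q @ t" "winv q"] by (simp add: F2_inv)
    moreover have "q \<otimes>\<^bsub>F2\<^esub> s = p"
      using c by (simp add: s_def)
    then have "q \<otimes>\<^bsub>F2\<^esub> s \<otimes>\<^bsub>F2\<^esub> inv\<^bsub>F2\<^esub> q = v"
      using c F2_mult_append[of p "winv q"] v assms(2) by (simp add: F2_inv)
    ultimately have conj: "u \<otimes>\<^bsub>F2\<^esub> v = q \<otimes>\<^bsub>F2\<^esub> t \<otimes>\<^bsub>F2\<^esub> inv\<^bsub>F2\<^esub> q"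
      "v = q \<otimes>\<^bsub>F2\<^esub> s \<otimes>\<^bsub>F2\<^esub> inv\<^bsub>F2\<^esub> q" by auto
    have "generate F2 {inv\<^bsub>F2\<^esub> q \<otimes>\<^bsub>F2\<^esub> (u \<otimes>\<^bsub>F2\<^esub> v) \<otimes>\<^bsub>F2\<^esub> inv\<^bsub>F2\<^esub> (inv\<^bsub>F2\<^esub> q),
        inv\<^bsub>F2\<^esub> q \<otimes>\<^bsub>F2\<^esub> v \<otimes>\<^bsub>F2\<^esub> inv\<^bsub>F2\<^esub> (inv\<^bsub>F2\<^esub> q)} = carrier F2"
      using uv c gen by (intro F2.generate_conj F2.generate_mult_left) auto
    moreover have "inv\<^bsub>F2\<^esub> q \<otimes>\<^bsub>F2\<^esub> (u \<otimes>\<^bsub>F2\<^esub> v) \<otimes>\<^bsub>F2\<^esub> inv\<^bsub>F2\<^esub> (inv\<^bsub>F2\<^esub> q) = t"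
      unfolding conj(1) using c by (simp add: F2.m_assoc)
    moreover have "inv\<^bsub>F2\<^esub> q \<otimes>\<^bsub>F2\<^esub> v \<otimes>\<^bsub>F2\<^esub> inv\<^bsub>F2\<^esub> (inv\<^bsub>F2\<^esub> q) = s"
      by (subst conj(2)) (use c s in \<open>simp add: F2.m_assoc\<close>)
    ultimately have "generate F2 {t, s} = carrier F2" by simp
    moreover have "length t < length u" using p(1) t ne v len by auto
    moreover have "length s \<le> length v"
      using length_mult[of "winv q" p] c v(1) by (simp add: s_def F2_inv)
    ultimately have "nielsen t s" using c s by (intro IH) (auto simp: F2_simps(1))
    from F2.nielsen_equiv.conj[OF this c(1)] have "nielsen (u \<otimes>\<^bsub>F2\<^esub> v) v"
      using conj by simp
    with no uv show False by (blast dest: F2.nielsen_equiv_multD)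
  qed
qed

lemma canc_inverse_half:
  assumes "reduced u" "reduced v" "v \<noteq> []"
  shows "\<not> (2 * canc u v = length v \<and> 2 * canc v (winv u) = length v)"
proof
  assume eq: "2 * canc u v = length v \<and> 2 * canc v (winv u) = length v"
  from canc_obtain[OF assms(1,2)] obtain u' p v' where
    p: "u = u' @ winv p" "v = p @ v'" "canc u v = length p" .
  have "reduced (winv u)" using assms(1) by simp
  from canc_obtain[OF assms(2) this] obtain v'' q u'' where
    q: "v = v'' @ winv q" "winv u = q @ u''" "canc v (winv u) = length q" .
  have len: "length q = length p" using eq p(3) q(3) by simp
  moreover have "winv u = p @ winv u'" using p(1) by simp
  ultimately have "q = p" using q(2) by simp
  moreover have "length v'' = length p"
    using eq p(3) len arg_cong[OF q(1), of length] by simp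
  ultimately have "v = p @ winv p" using p(2) q(1) by simp
  with assms(2,3) show False
    by (cases p rule: rev_cases) (auto simp: reduced_append reduced_Cons)
qed

lemma nielsen_winv:
  assumes "nielsen X Y" "U = X \<or> U = winv X" "V = Y \<or> V = winv Y" "reduced X" "reduced Y"
  shows "nielsen U V"
proof -
  have "nielsen U Y"
    using assms(2) F2.nielsen_equiv.inv[OF assms(1)] assms(1,4) by (auto simp: F2_inv)
  then show ?thesis
    using assms(3,5) F2.nielsen_equiv_inv_right[of _ _ U Y] by (auto simp: F2_inv)
qed

lemma generate_winv:
  assumes "generate F2 {X, Y} = carrier F2" "U = X \<or> U = winv X" "V = Y \<or> V = winv Y"
    "reduced X" "reduced Y"
  shows "generate F2 {U, V} = carrier F2"
proof -
  have XY: "X \<in> carrier F2" "Y \<in> carrier F2" "U \<in> carrier F2"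
    using assms(2,4,5) by (auto simp: F2_simps(1))
  have "generate F2 {U, Y} = carrier F2"
    using assms(2) F2.generate_inv_left[OF XY(1,2) assms(1)] assms(1,4) by (auto simp: F2_inv)
  then have 1: "generate F2 {Y, U} = carrier F2"
    by (simp only: insert_commute)
  then have "generate F2 {V, U} = carrier F2"
    using assms(3) F2.generate_inv_left[OF XY(2,3) 1] assms(5) by (auto simp: F2_inv)
  then show ?thesis
    by (simp only: insert_commute)
qed

lemma generating_pair_nielsen:
  assumes "reduced X" "reduced Y" "generate F2 {X, Y} = carrier F2"
  shows "nielsen X Y"
  using assms
proof (induction "length X + length Y" arbitrary: X Y rule: less_induct)
  case less
  note red = less.prems(1,2) and gen = less.prems(3)
  show ?case
  proof (rule ccontr)
    assume no: "\<not> nielsen X Y"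
    have XY: "X \<in> carrier F2" "Y \<in> carrier F2" using red by (auto simp: F2_simps)
    obtain h where h: "h \<in> hom F2 F2" "h [(A, True)] = X" "h [(B, True)] = Y"
      using F2_universal[OF group_F2 XY] by blast
    interpret h: group_hom F2 F2 h
      by unfold_locales (rule h(1))
    have letter: "[x] \<in> carrier F2" for x by (simp add: F2_simps reduced_Cons)
    have inv: "h [inv_letter x] = winv (h [x])" for x
    proof -
      have "h (inv\<^bsub>F2\<^esub> [x]) = inv\<^bsub>F2\<^esub> (h [x])" using letter by simp
      then show ?thesis
        using h.hom_closed[OF letter[of x]] by (simp add: F2_inv F2_simps(1) reduced_Cons)
    qed
    have hAB: "h [(A, b)] = (if b then X else winv X)" "h [(B, b)] = (if b then Y else winv Y)" for b
      using h(2,3) inv[of "(A, True)"] inv[of "(B, True)"] by (auto simp: inv_letter_def)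
    have rh: "reduced (h [x])" for x
      using h.hom_closed[OF letter[of x]] by (simp add: F2_simps(1))
    \<comment> \<open>The triple condition involves both orders and all signs, so minimality of the
      counterexample is transferred to every such pair of images.\<close>
    have pair: "generate F2 {h [x], h [y]} = carrier F2 \<and> \<not> nielsen (h [x]) (h [y]) \<and>
        length (h [x]) + length (h [y]) = length X + length Y"
      if xy: "fst x \<noteq> fst y" for x y
    proof -
      obtain U V where UV: "{h [x], h [y]} = {U, V}" "h [x] = U \<and> h [y] = V \<or> h [x] = V \<and> h [y] = U"
        "U = X \<or> U = winv X" "V = Y \<or> V = winv Y"
      proof -
        obtain c d where "x = (A, c) \<and> y = (B, d) \<or> x = (B, d) \<and> y = (A, c)"
          using xy by (cases x; cases y; cases "fst x"; cases "fst y") auto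
        then show thesis
          using that[of "h [(A, c)]" "h [(B, d)]"] hAB by (auto simp: insert_commute)
      qed
      have "X = U \<or> X = winv U" "Y = V \<or> Y = winv V" "reduced U" "reduced V"
        using UV(3,4) red by auto
      then have "\<not> nielsen U V" using nielsen_winv[of U V X Y] no by blast
      moreover have "generate F2 {U, V} = carrier F2" using generate_winv[OF gen UV(3,4) red] .
      moreover have "\<not> nielsen V U"
        using calculation(1) F2.nielsen_equiv.swap by metis
      moreover have "length U = length X" "length V = length Y"
        using UV(3,4) by auto
      ultimately show ?thesis
        using UV(1,2) by auto
    qed
    \<comment> \<open>Otherwise a single element would generate the free group of rank two.\<close>
    have ne: "h [x] \<noteq> []" for x
    proof
      assume 0: "h [x] = []"
      obtain y :: letter where "fst y \<noteq> fst x" by (metis fst_conv generator.distinct(1))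
      with pair[of y x] 0 generate_singleton_ne[OF rh[of y]] show False by simp
    qed
    have half: "2 * canc (h [x]) (h [y]) \<le> length (h [x])" "2 * canc (h [x]) (h [y]) \<le> length (h [y])"
      "\<not> (2 * canc (h [x]) (h [y]) = length (h [y]) \<and> 2 * canc (h [y]) (h [x]) = length (h [y]))"
      if "fst x \<noteq> fst y" for x y
      using canc_less_of_shorter[OF rh[of x] rh[of y]] pair[OF that] less.hyps ne[of y] by metis+
    have small: "canc (h [x]) (h [y]) + canc (h [y]) (h [z]) < length (h [y])"
      if xy: "y \<noteq> inv_letter x" and yz: "z \<noteq> inv_letter y" for x y z
    proof -
      have same: "v = u" if "v \<noteq> inv_letter u" "fst u = fst v" for u v
        using that by (cases u; cases v) (auto simp: inv_letter_def)
      have self: "2 * canc (h [y]) (h [y]) < length (h [y])"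
        using canc_self[OF rh ne] .
      consider "fst x = fst y" "fst y = fst z" | "fst x = fst y" "fst y \<noteq> fst z"
        | "fst x \<noteq> fst y" "fst y = fst z" | "fst x \<noteq> fst y" "fst y \<noteq> fst z" by blast
      then show ?thesis
      proof cases
        case 1
        then have "x = y" "z = y" using same[OF xy] same[OF yz] by blast+
        then show ?thesis using self by simp
      next
        case 2
        then have "x = y" using same[OF xy] by blast
        then show ?thesis using self half(1)[OF 2(2)] by simp
      next
        case 3
        then have "z = y" using same[OF yz] by blast
        then show ?thesis using self half(2)[OF 3(1)] by simp
      next
        case 4
        \<comment> \<open>With two generators the outer letters are equal or inverse. Cancelling
          half of the middle factor on both sides is excluded by minimality in the first case and by
          reducedness in the second.\<close>
        then have "fst z = fst x" by (metis generator.exhaust)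
        then have "z = x \<or> z = inv_letter x" using same[of z x] by metis
        moreover have "\<not> (2 * canc (h [x]) (h [y]) = length (h [y]) \<and> 2 * canc (h [y]) (h [z]) = length (h [y]))"
          if "z = x" using that half(3)[OF 4(1)] by simp
        moreover have "\<not> (2 * canc (h [x]) (h [y]) = length (h [y]) \<and> 2 * canc (h [y]) (h [z]) = length (h [y]))"
          if "z = inv_letter x" using that canc_inverse_half[OF rh[of x] rh[of y] ne] inv by simp
        ultimately show ?thesis using half(2)[OF 4(1)] half(1)[OF 4(2)] by linarith
      qed
    qed
    have long: "length w \<le> length (h w)" if "reduced w" for w
      using hom_length_mono[OF h(1) _ that] small by blast
    have onto: "\<exists>y. h [y] = [x]" for x
    proof -
      have "h ` carrier F2 = carrier F2"
        using h.generate_img[of "{[(A, True)], [(B, True)]}"] h(2,3) gen letter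
        by (simp add: F2_generated)
      then have "[x] \<in> h ` carrier F2" using letter[of x] by simp
      then obtain w where w: "reduced w" "h w = [x]"
        by (metis F2_simps(1) imageE mem_Collect_eq)
      then have "length w \<le> 1" using long[OF w(1)] by simp
      moreover have "w \<noteq> []" using w(2) h.hom_one by (auto simp: F2_simps(3))
      ultimately show ?thesis using w(2) by (cases w) auto
    qed
    obtain x y where x: "h [x] = [(A, True)]" and y: "h [y] = [(B, True)]"
      using onto by metis
    have "fst x \<noteq> fst y"
    proof
      assume "fst x = fst y"
      then have "y = x \<or> y = inv_letter x" by (cases x; cases y) (auto simp: inv_letter_def)
      then have "h [y] = h [x] \<or> h [y] = winv (h [x])" using inv[of x] by auto
      then show False unfolding x y by (simp add: inv_letter_def)
    qed
    with pair[of x y] x y F2.nielsen_equiv.base show False by simp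
  qed
qed

section \<open>Positive pairs\<close>

inductive (in group) pos_pair :: "'a \<Rightarrow> 'a \<Rightarrow> 'a \<Rightarrow> 'a \<Rightarrow> bool" for a b where
  base: "pos_pair a b a b"
| left: "pos_pair a b x y \<Longrightarrow> pos_pair a b (x \<otimes> y) y"
| right: "pos_pair a b x y \<Longrightarrow> pos_pair a b x (x \<otimes> y)"
| conj: "pos_pair a b x y \<Longrightarrow> g \<in> carrier G \<Longrightarrow>
    pos_pair a b (g \<otimes> x \<otimes> inv g) (g \<otimes> y \<otimes> inv g)"

text \<open>Invariance under swapping and inverting is built in, so that multiplication is the only
  Nielsen move requiring work. The two choices of \<open>a'\<close> later yield the two enumeration
  schemes.\<close>

definition (in group) signed_pair :: "'a \<Rightarrow> 'a \<Rightarrow> 'a \<Rightarrow> 'a \<Rightarrow> bool" where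
  "signed_pair a b x y \<longleftrightarrow> (\<exists>a' \<in> {a, inv a}. \<exists>x' \<in> {x, inv x}. \<exists>y' \<in> {y, inv y}.
     pos_pair a' b x' y' \<or> pos_pair a' b y' x')"

context group
begin

lemma pos_pair_closed:
  assumes "pos_pair a b x y" "a \<in> carrier G" "b \<in> carrier G"
  shows "x \<in> carrier G" "y \<in> carrier G"
  using assms by (induction) auto

lemma signed_pairI: "pos_pair a' b x y \<Longrightarrow> a' \<in> {a, inv a} \<Longrightarrow> signed_pair a b x y"
  unfolding signed_pair_def by blast

lemma signed_pair_swap: "signed_pair a b x y \<Longrightarrow> signed_pair a b y x"
  unfolding signed_pair_def by blast

lemma signed_pair_inv:
  assumes "signed_pair a b x y" "x \<in> carrier G"
  shows "signed_pair a b (inv x) y"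
  using assms by (simp add: signed_pair_def disj_commute)

lemma signed_pair_inv_right:
  assumes "signed_pair a b x y" "y \<in> carrier G"
  shows "signed_pair a b x (inv y)"
  by (rule signed_pair_swap[OF signed_pair_inv[OF signed_pair_swap[OF assms(1)] assms(2)]])

lemma signed_pair_conj:
  assumes "signed_pair a b x y" "x \<in> carrier G" "y \<in> carrier G" "g \<in> carrier G"
  shows "signed_pair a b (g \<otimes> x \<otimes> inv g) (g \<otimes> y \<otimes> inv g)"
proof -
  obtain a' x' y' where *: "a' \<in> {a, inv a}" "x' \<in> {x, inv x}" "y' \<in> {y, inv y}"
    "pos_pair a' b x' y' \<or> pos_pair a' b y' x'"
    using assms(1) unfolding signed_pair_def by blast
  have inv: "inv (g \<otimes> z \<otimes> inv g) = g \<otimes> inv z \<otimes> inv g" if "z \<in> carrier G" for z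
    using that assms(4) by (simp add: inv_mult_group m_assoc)
  have "g \<otimes> x' \<otimes> inv g \<in> {g \<otimes> x \<otimes> inv g, inv (g \<otimes> x \<otimes> inv g)}"
    "g \<otimes> y' \<otimes> inv g \<in> {g \<otimes> y \<otimes> inv g, inv (g \<otimes> y \<otimes> inv g)}"
    using *(2,3) assms(2,3) by (auto simp: inv)
  moreover have "pos_pair a' b (g \<otimes> x' \<otimes> inv g) (g \<otimes> y' \<otimes> inv g) \<or>
      pos_pair a' b (g \<otimes> y' \<otimes> inv g) (g \<otimes> x' \<otimes> inv g)"
    using *(4) pos_pair.conj[OF _ assms(4)] by blast
  ultimately show ?thesis
    using *(1) unfolding signed_pair_def by blast
qed

text \<open>Conjugation by the factor that is kept makes multiplication from the left and from the
  right the same move.\<close>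

lemma conj_mult_self:
  assumes "x \<in> carrier G" "y \<in> carrier G"
  shows "y \<otimes> (x \<otimes> y) \<otimes> inv y = y \<otimes> x" "inv y \<otimes> (y \<otimes> x) \<otimes> inv (inv y) = x \<otimes> y"
    "y \<otimes> y \<otimes> inv y = y" "inv y \<otimes> y \<otimes> inv (inv y) = y"
  using assms by (simp_all add: m_assoc)

lemma signed_pair_comm_left:
  assumes "signed_pair a b (x \<otimes> y) y" "x \<in> carrier G" "y \<in> carrier G"
  shows "signed_pair a b (y \<otimes> x) y"
  using signed_pair_conj[OF assms(1) _ assms(3,3)] assms(2,3) conj_mult_self[OF assms(2,3)] by simp

lemma signed_pair_comm_right:
  assumes "signed_pair a b x (x \<otimes> y)" "x \<in> carrier G" "y \<in> carrier G"
  shows "signed_pair a b x (y \<otimes> x)"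
  using signed_pair_conj[OF assms(1), of "inv x"] assms(2,3) conj_mult_self[OF assms(3,2)] by simp

text \<open>A quotient undoes the last step of the construction; for the initial pair it is
  \<open>a b\<inverse> = (b a\<inverse>)\<inverse>\<close>, which passes from \<open>a\<close> to \<open>inv a\<close>.\<close>

lemma signed_pair_quotient:
  assumes "pos_pair a' b x y" "a' \<in> {a, inv a}" "a \<in> carrier G" "b \<in> carrier G"
  shows "signed_pair a b (x \<otimes> inv y) y \<and> signed_pair a b x (inv x \<otimes> y)"
  using assms(1)
proof (induction)
  case base
  have a': "a' \<in> carrier G" "inv a' \<in> {a, inv a}" using assms(2,3) by auto
  have "signed_pair a b (b \<otimes> inv a') b"
    using pos_pair.left[OF pos_pair.base, of "inv a'" b] a' assms(4)
    by (intro signed_pair_comm_left[of a b "inv a'" b] signed_pairI) auto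
  then have "signed_pair a b (inv (b \<otimes> inv a')) b"
    using a' assms(4) by (intro signed_pair_inv) auto
  moreover have "signed_pair a b (inv a') (inv a' \<otimes> b)"
    using pos_pair.right[OF pos_pair.base, of "inv a'" b] a' by (blast intro: signed_pairI)
  then have "signed_pair a b (inv (inv a')) (inv a' \<otimes> b)"
    by (rule signed_pair_inv) (use a' in auto)
  ultimately show ?case
    using a' assms(4) by (simp add: inv_mult_group)
next
  case (left x y)
  have c: "x \<in> carrier G" "y \<in> carrier G"
    using pos_pair_closed[OF left.hyps] assms by auto
  have s: "signed_pair a b x y" using left.hyps assms(2) by (rule signed_pairI)
  have "signed_pair a b x (x \<otimes> y)"
    using pos_pair.right[OF left.hyps] assms(2) by (rule signed_pairI)
  then have "signed_pair a b (inv x) (x \<otimes> y)"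
    by (rule signed_pair_inv) (use c in auto)
  \<comment> \<open>This conjugation fixes \<open>x y\<close> and sends the inverse of
    \<open>x\<close> to the quotient of \<open>x y\<close> and \<open>y\<close> that is
    wanted.\<close>
  from signed_pair_conj[OF this, of "inv (x \<otimes> y)"]
  have "signed_pair a b (inv y \<otimes> (inv x \<otimes> y)) (x \<otimes> y)"
    using c by (simp add: m_assoc inv_mult_group)
  then show ?case using signed_pair_swap s c by (simp add: m_assoc inv_mult_group)
next
  case (right x y)
  have c: "x \<in> carrier G" "y \<in> carrier G"
    using pos_pair_closed[OF right.hyps] assms by auto
  have s: "signed_pair a b x y" using right.hyps assms(2) by (rule signed_pairI)
  have "signed_pair a b (x \<otimes> y) y"
    using pos_pair.left[OF right.hyps] assms(2) by (rule signed_pairI)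
  then have "signed_pair a b (x \<otimes> y) (inv y)"
    by (rule signed_pair_inv_right) (use c in auto)
  from signed_pair_conj[OF this, of "x \<otimes> y"]
  have "signed_pair a b (x \<otimes> y) (x \<otimes> (inv y \<otimes> inv x))"
    using c by (simp add: m_assoc inv_mult_group)
  then show ?case using signed_pair_swap s c by (simp add: m_assoc inv_mult_group)
next
  case (conj x y g)
  have c: "x \<in> carrier G" "y \<in> carrier G"
    using pos_pair_closed[OF conj.hyps(1)] assms by auto
  have "signed_pair a b (g \<otimes> (x \<otimes> inv y) \<otimes> inv g) (g \<otimes> y \<otimes> inv g)"
    "signed_pair a b (g \<otimes> x \<otimes> inv g) (g \<otimes> (inv x \<otimes> y) \<otimes> inv g)"
    using conj c by (auto intro: signed_pair_conj)
  then show ?case using c conj.hyps(2) by (simp add: m_assoc inv_mult_group)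
qed

text \<open>Up to inversion and conjugation, the four products of \<open>u\<close> or its inverse
  with \<open>v\<close> or its inverse are only two.\<close>

lemma signed_pair_mult_aux:
  assumes "signed_pair a b (u \<otimes> v) v" "signed_pair a b (u \<otimes> inv v) v"
    "u \<in> carrier G" "v \<in> carrier G" "x \<in> {u, inv u}" "y \<in> {v, inv v}"
  shows "signed_pair a b (x \<otimes> y) y"
proof -
  have "signed_pair a b (inv (v \<otimes> u)) (inv v)"
    using assms(3,4) signed_pair_comm_left[OF assms(1,3,4)] by (simp add: signed_pair_inv signed_pair_inv_right)
  moreover have "signed_pair a b (inv v \<otimes> u) v"
    using signed_pair_conj[OF assms(2), of "inv v"] assms(3,4) by (simp add: m_assoc)
  then have "signed_pair a b (inv (inv v \<otimes> u)) v"
    using assms(3,4) by (simp add: signed_pair_inv)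
  moreover have "signed_pair a b (u \<otimes> inv v) (inv v)"
    using assms by (simp add: signed_pair_inv_right)
  ultimately show ?thesis
    using assms by (auto simp: inv_mult_group)
qed

lemma signed_pair_mult:
  assumes "signed_pair a b x y" "x \<in> carrier G" "y \<in> carrier G" "a \<in> carrier G" "b \<in> carrier G"
  shows "signed_pair a b (x \<otimes> y) y"
proof -
  obtain a' x' y' where *: "a' \<in> {a, inv a}" "x' \<in> {x, inv x}" "y' \<in> {y, inv y}"
    "pos_pair a' b x' y' \<or> pos_pair a' b y' x'"
    using assms(1) unfolding signed_pair_def by blast
  have c: "x' \<in> carrier G" "y' \<in> carrier G" "x \<in> {x', inv x'}" "y \<in> {y', inv y'}"
    using *(2,3) assms(2,3) by auto
  from *(4) show ?thesis
  proof
    assume p: "pos_pair a' b x' y'"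
    then show ?thesis
      using signed_pair_mult_aux[OF _ _ c] signed_pair_quotient[OF p *(1) assms(4,5)]
        signed_pairI[OF pos_pair.left[OF p] *(1)] by blast
  next
    assume p: "pos_pair a' b y' x'"
    have q: "signed_pair a b y' (inv y' \<otimes> x')"
      using signed_pair_quotient[OF p *(1) assms(4,5)] by blast
    have "signed_pair a b y' (x' \<otimes> inv y')"
      using signed_pair_conj[OF q, of y'] c by (simp add: m_assoc)
    moreover have "signed_pair a b y' (x' \<otimes> y')"
      using signed_pair_comm_right[OF signed_pairI[OF pos_pair.right[OF p] *(1)]] c by blast
    ultimately show ?thesis
      using signed_pair_mult_aux[OF _ _ c] signed_pair_swap by blast
  qed
qed

lemma nielsen_equiv_signed_pair:
  assumes "nielsen_equiv a b x y" "a \<in> carrier G" "b \<in> carrier G"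
  shows "x \<in> carrier G \<and> y \<in> carrier G \<and> signed_pair a b x y"
  using assms(1)
proof induction
  case base
  then show ?case using assms signed_pairI[OF pos_pair.base] by blast
next
  case (mult x y)
  then show ?case using assms(2,3) by (auto intro: signed_pair_mult)
next
  case (conj x y g)
  then show ?case by (auto intro: signed_pair_conj)
next
  case (inv x y)
  then show ?case by (auto intro: signed_pair_inv)
next
  case (swap x y)
  then show ?case using signed_pair_swap by metis
qed

end

section \<open>Farey pairs and parents\<close>

text \<open>The sign of the determinant makes \<open>m/n\<close> the smaller fraction.
  \<open>r/s\<close> may be 1/0, but \<open>n\<close> cannot vanish.\<close>

definition farey :: "int \<Rightarrow> int \<Rightarrow> int \<Rightarrow> int \<Rightarrow> bool" where
  "farey m n r s \<longleftrightarrow> 0 \<le> m \<and> 0 \<le> n \<and> 0 \<le> r \<and> 0 \<le> s \<and> n * r - m * s = 1"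

lemma farey_base: "farey 0 1 1 0"
  by (simp add: farey_def)

lemma farey_left: "farey m n r s \<Longrightarrow> farey m n (m + r) (n + s)"
  by (simp add: farey_def algebra_simps)

lemma farey_right: "farey m n r s \<Longrightarrow> farey (m + r) (n + s) r s"
  by (simp add: farey_def algebra_simps)

lemma farey_pos: "farey m n r s \<Longrightarrow> n > 0 \<and> r > 0"
  by (cases "n = 0"; cases "r = 0")
    (auto simp: farey_def dest: mult_nonneg_nonneg[of m s])

lemma farey_coprime: "farey m n r s \<Longrightarrow> coprime m n \<and> coprime r s"
  unfolding farey_def by (metis coprimeI dvd_diff dvd_mult dvd_mult2)

text \<open>The subtractive Euclidean algorithm on columns: a nonnegative matrix of determinant 1
  has one column dominating the other unless it is the initial one.\<close>

lemma farey_induct [consumes 1, case_names base left right]: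
  assumes "farey m n r s" "P 0 1 1 0"
    and left: "\<And>m n r s. farey m n r s \<Longrightarrow> P m n r s \<Longrightarrow> P m n (m + r) (n + s)"
    and right: "\<And>m n r s. farey m n r s \<Longrightarrow> P m n r s \<Longrightarrow> P (m + r) (n + s) r s"
  shows "P m n r s"
  using assms(1)
proof (induction "nat (m + n + r + s)" arbitrary: m n r s rule: less_induct)
  case less
  note f = less.prems
  note np = farey_pos[OF f]
  have nonneg: "0 \<le> m" "0 \<le> n" "0 \<le> r" "0 \<le> s" and det: "n * r - m * s = 1"
    using f by (auto simp: farey_def)
  consider "r \<le> m" "s \<le> n" | "m \<le> r" "n \<le> s" | "m < r" "s < n" | "r < m" "n < s" by linarith
  then show ?case
  proof cases
    case 1
    then have f': "farey (m - r) (n - s) r s"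
      using nonneg det by (simp add: farey_def algebra_simps)
    have "P (m - r) (n - s) r s"
      using np nonneg 1 by (intro less.hyps f') auto
    from right[OF f' this] show ?thesis by simp
  next
    case 2
    then have f': "farey m n (r - m) (s - n)"
      using nonneg det by (simp add: farey_def algebra_simps)
    have "P m n (r - m) (s - n)"
      using np nonneg 2 by (intro less.hyps f') auto
    from left[OF f' this] show ?thesis by simp
  next
    case 3
    \<comment> \<open>As \<open>n * r\<close> is \<open>m * s + 1\<close>, this leaves
      \<open>m + s \<le> 0\<close>, hence the initial pair.\<close>
    then have "(s + 1) * (m + 1) \<le> n * r"
      using nonneg by (intro mult_mono) auto
    then have "s = 0" "m = 0"
      using det nonneg by (auto simp: algebra_simps)
    moreover have "n = 1" "r = 1"
      using det nonneg \<open>m = 0\<close> by (auto simp: zmult_eq_1_iff)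
    ultimately show ?thesis using assms(2) by simp
  next
    case 4
    then have "n * r \<le> s * m" using nonneg by (intro mult_mono) auto
    with det show ?thesis by (simp add: mult.commute)
  qed
qed

text \<open>For a mediant \<open>p/q\<close>, the number \<open>n\<close> is the inverse of
  \<open>p\<close> modulo \<open>q\<close> in the range from 1 to \<open>q\<close>, and
  \<open>n\<close> determines the rest.\<close>

lemma farey_unique:
  assumes "farey m n r s" "farey m' n' r' s'" "m + r = m' + r'" "n + s = n' + s'"
  shows "m = m' \<and> n = n' \<and> r = r' \<and> s = s'"
proof -
  define p q where "p = m + r" and "q = n + s"
  have pq: "n * p - m * q = 1" "n' * p - m' * q = 1"
  proof -
    show "n * p - m * q = 1" using assms(1) by (simp add: p_def q_def farey_def algebra_simps)
    show "n' * p - m' * q = 1"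
      unfolding p_def q_def assms(3,4) using assms(2) by (simp add: farey_def algebra_simps)
  qed
  have q: "q > 0" "0 < n" "n \<le> q" "0 < n'" "n' \<le> q"
    using farey_pos[OF assms(1)] farey_pos[OF assms(2)] assms by (auto simp: q_def farey_def)
  have eq: "(n - n') * p = (m - m') * q"
    using pq by (simp add: algebra_simps)
  have "coprime q p"
    using farey_coprime[OF farey_left[OF assms(1)]] by (simp add: p_def q_def coprime_commute)
  moreover have "q dvd (n - n') * p" unfolding eq by simp
  ultimately have "q dvd n - n'" by (simp add: coprime_dvd_mult_left_iff)
  moreover have "\<bar>n - n'\<bar> < q" using q by linarith
  ultimately have n: "n = n'" using zdvd_imp_le[of q "\<bar>n - n'\<bar>"] by (cases "n = n'") auto
  then have "m = m'" using eq q(1) by simp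
  with n assms(3,4) show ?thesis by simp
qed

text \<open>Modulo 2 the two fractions and their mediant are the three nonzero vectors of the plane
  over the field with two elements; only 1/1 is of odd type.\<close>

lemma farey_parity:
  assumes "farey m n r s"
  shows "even (m * n) \<and> even (r * s) \<and> odd ((m + r) * (n + s)) \<or>
    odd (m * n) \<and> even (r * s) \<and> even ((m + r) * (n + s)) \<or>
    even (m * n) \<and> odd (r * s) \<and> even ((m + r) * (n + s))"
proof -
  have "odd (n * r - m * s)" using assms by (simp add: farey_def)
  then show ?thesis by auto
qed

section \<open>Parents of a slope as Farey neighbours\<close>

definition slp :: "int \<Rightarrow> int \<Rightarrow> slope" where
  "slp p q = (if q = 0 then Infty else Frac (Fract p q))"

lemma slp_simps [simp]: "slp 1 0 = Infty" "slp 0 1 = Frac 0" "slp 1 1 = Frac 1"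
  by (simp_all add: slp_def rat_number_collapse)

lemma slp_num_den [simp]: "slp (num x) (den x) = x"
proof (cases x)
  case (Frac t)
  obtain p q where pq: "quotient_of t = (p, q)" by force
  then show ?thesis
    using Frac quotient_of_div[OF pq] quotient_of_denom_pos[OF pq] by (simp add: slp_def Fract_of_int_quotient)
qed (simp add: slp_def)

lemma num_den_Fract:
  "coprime p q \<Longrightarrow> 0 < q \<Longrightarrow> num (Frac (Fract p q)) = p \<and> den (Frac (Fract p q)) = q"
  by (simp add: quotient_of_Fract normalize_stable)

lemma num_den_slp_farey:
  assumes "farey m n r s"
  shows "num (slp m n) = m" "den (slp m n) = n" "num (slp r s) = r" "den (slp r s) = s"
proof -
  show "num (slp m n) = m" "den (slp m n) = n"
    using num_den_Fract[of m n] farey_coprime[OF assms] farey_pos[OF assms] by (auto simp: slp_def)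
  have "r = 1" if "s = 0"
    using assms that by (auto simp: farey_def zmult_eq_1_iff)
  moreover have "s \<ge> 0" using assms by (simp add: farey_def)
  ultimately show "num (slp r s) = r" "den (slp r s) = s"
    using num_den_Fract[of r s] farey_coprime[OF assms] by (auto simp: slp_def)
qed

lemma num_den_Frac:
  "den (Frac t) > 0" "t = of_int (num (Frac t)) / of_int (den (Frac t))" "coprime (num (Frac t)) (den (Frac t))"
  by (cases "quotient_of t"; simp add: quotient_of_denom_pos quotient_of_div quotient_of_coprime)+

lemma den_nonneg: "den x \<ge> 0"
  using num_den_Frac(1) by (cases x) (auto intro: less_imp_le)

lemma num_pos: "0 < t \<Longrightarrow> 0 < num (Frac t)"
  using num_den_Frac(1,2)[of t] by (metis of_int_0_less_iff zero_less_divide_iff less_asym)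

lemma num_nonneg: "0 \<le> t \<Longrightarrow> 0 \<le> num (Frac t)"
  using num_pos[of t] by (cases "t = 0") auto

text \<open>Prepending \<open>a\<close> is the unimodular map from \<open>(p, q)\<close> to
  \<open>(a p + q, p)\<close>, so lowest terms persist; 1/0 fits the same formula.\<close>

lemma num_den_cf_Cons:
  assumes "num (cf_val bs) > 0"
  shows "num (cf_val (a # bs)) = a * num (cf_val bs) + den (cf_val bs)"
    "den (cf_val (a # bs)) = num (cf_val bs)"
proof -
  have "num (cf_val (a # bs)) = a * num (cf_val bs) + den (cf_val bs) \<and>
    den (cf_val (a # bs)) = num (cf_val bs)"
  proof (cases "cf_val bs")
    case (Frac t)
    define p q where "p = num (Frac t)" and "q = den (Frac t)"
    have p: "p > 0" using assms Frac p_def by simp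
    have t: "t = of_int p / of_int q" "q > 0" "coprime p q"
      using num_den_Frac[of t] by (auto simp: p_def q_def)
    have "of_int a + 1 / t = Fract (a * p + q) p"
      unfolding t(1) using p t(2) by (simp add: Fract_of_int_quotient field_simps)
    moreover have "coprime (a * p + q) p"
      using t(3) by (metis coprime_iff_gcd_eq_1 gcd_add_mult gcd.commute)
    ultimately show ?thesis
      using num_den_Fract[of "a * p + q" p] p Frac by (simp add: p_def q_def)
  qed simp
  then show "num (cf_val (a # bs)) = a * num (cf_val bs) + den (cf_val bs)"
    "den (cf_val (a # bs)) = num (cf_val bs)" by auto
qed

text \<open>Prepending a partial quotient is linear with determinant -1. It preserves the mediant
  relation and flips the sign of the determinant of the parents, whose order thus alternates with
  the length; hence the absolute value.\<close>

lemma parents_cf_farey: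
  assumes "proper_cf as" "cf_val as = Frac r" "r > 0"
    "y = cf_val (butlast as)" "z = cf_val (butlast as @ [last as - 1])"
  shows "num y + num z = num (Frac r) \<and> den y + den z = den (Frac r) \<and>
    num y \<ge> 0 \<and> num z \<ge> 0 \<and> \<bar>den y * num z - num y * den z\<bar> = 1"
  using assms
proof (induction as arbitrary: r y z)
  case Nil
  then show ?case by simp
next
  case (Cons a as)
  show ?case
  proof (cases "as = []")
    case True
    then have "r = of_int a" "y = Infty" "z = Frac (of_int (a - 1))" "a > 0"
      using Cons.prems by auto
    then show ?thesis by (simp del: of_int_diff)
  next
    case False
    note * = proper_cf_Cons_val(3)[OF Cons.prems(1,2) False]
    define y' z' where "y' = cf_val (butlast as)" and "z' = cf_val (butlast as @ [last as - 1])"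
    have as: "\<forall>b \<in> set as. b > 0" "last as \<ge> 2"
      using Cons.prems(1) False by (auto simp: proper_cf_Cons)
    obtain t where t: "t > 1" "cf_val as = Frac t" using cf_val_gt_1[OF False as] by blast
    have IH: "num y' + num z' = num (Frac t) \<and> den y' + den z' = den (Frac t) \<and>
      num y' \<ge> 0 \<and> num z' \<ge> 0 \<and> \<bar>den y' * num z' - num y' * den z'\<bar> = 1"
      by (rule Cons.IH[OF _ t(2) _ y'_def z'_def]) (use * t(1) in auto)
    have z': "num z' > 0"
    proof -
      obtain z where "z \<ge> 1" "z' = Frac z"
        using cf_val_ge_1[of "butlast as @ [last as - 1]"] as
        by (auto simp: z'_def dest: in_set_butlastD)
      then show ?thesis using num_pos by simp
    qed
    have y': "num y' > 0"
    proof (cases "butlast as = []")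
      case False
      then obtain y where "y \<ge> 1" "y' = Frac y"
        using cf_val_ge_1[of "butlast as"] as by (auto simp: y'_def dest: in_set_butlastD)
      then show ?thesis using num_pos by simp
    qed (simp add: y'_def)
    have a: "a \<ge> 0" using Cons.prems(1) by (simp add: proper_cf_Cons)
    have y: "num y = a * num y' + den y'" "den y = num y'"
      using num_den_cf_Cons[of "butlast as" a] y' False by (auto simp: Cons.prems(4) y'_def)
    have z: "num z = a * num z' + den z'" "den z = num z'"
      using num_den_cf_Cons[of "butlast as @ [last as - 1]" a] z' False
      by (auto simp: Cons.prems(5) z'_def)
    have r: "num (Frac r) = a * num (Frac t) + den (Frac t)" "den (Frac r) = num (Frac t)"
      using num_den_cf_Cons[of as a] t num_pos[of t] Cons.prems(2) by auto
    have "den y * num z - num y * den z = - (den y' * num z' - num y' * den z')"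
      unfolding y z by (simp add: algebra_simps)
    then have "\<bar>den y * num z - num y * den z\<bar> = 1" using IH by linarith
    moreover have "num y \<ge> 0" "num z \<ge> 0"
      unfolding y z using a y' z' den_nonneg by auto
    moreover have t': "num (Frac t) = num y' + num z'" "den (Frac t) = den y' + den z'"
      using IH by simp_all
    have "num y + num z = num (Frac r)" "den y + den z = den (Frac r)"
      unfolding y z r t' by (simp_all add: algebra_simps)
    ultimately show ?thesis by blast
  qed
qed

lemma less_pos_iff: "less_pos x y \<longleftrightarrow> num x * den y < num y * den x"
proof (cases x; cases y)
  fix a b assume xy: "x = Frac a" "y = Frac b"
  define p q p' q' where "p = num x" "q = den x" "p' = num y" "q' = den y"
  have "a = of_int p / of_int q" "b = of_int p' / of_int q'" "q > 0" "q' > 0"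
    using num_den_Frac(1,2)[of a] num_den_Frac(1,2)[of b] xy p_q_p'_q'_def by auto
  note ab = this
  have "a < b \<longleftrightarrow> of_int (p * q') < (of_int (p' * q) :: rat)"
    unfolding ab(1,2) using ab(3,4) by (simp add: field_simps)
  then show ?thesis unfolding of_int_less_iff using xy p_q_p'_q'_def by simp
qed (simp_all add: num_den_Frac(1) not_less less_imp_le[OF num_den_Frac(1)] del: num.simps(1) den.simps(1))

text \<open>The order required by the labelling fixes the sign of the determinant that the continued
  fraction leaves open.\<close>

lemma labelled_parents_pos_farey:
  assumes "r > 0" "labelled_parents_pos r (u, v)"
  shows "farey (num u) (den u) (num v) (den v)"
    "num u + num v = num (Frac r)" "den u + den v = den (Frac r)"
proof -
  define as where "as = cf_expansion r"
  define y z where "y = cf_val (butlast as)" and "z = cf_val (butlast as @ [last as - 1])"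
  have P: "parents r = {y, z}"
    using assms by (simp add: parents_def parents_of_positive_def as_def y_def z_def Let_def)
  have *: "num y + num z = num (Frac r) \<and> den y + den z = den (Frac r) \<and>
    num y \<ge> 0 \<and> num z \<ge> 0 \<and> \<bar>den y * num z - num y * den z\<bar> = 1"
    using parents_cf_farey[OF _ _ _ y_def z_def, of r] cf_expansion[of r] assms(1) by (simp add: as_def)
  have uv: "{u, v} = {y, z}" "less_pos u (Frac r)" "less_pos (Frac r) v"
    using assms(2) P by (auto simp: labelled_parents_pos_def)
  have "less_pos u v" using uv(2,3) by (cases u; cases v) auto
  then have "num u * den v < num v * den u" by (simp add: less_pos_iff)
  then show "farey (num u) (den u) (num v) (den v)"
    "num u + num v = num (Frac r)" "den u + den v = den (Frac r)"
    using * uv(1) den_nonneg by (auto simp: doubleton_eq_iff farey_def algebra_simps)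
qed

text \<open>No expansion is computed: the labelled parents of the mediant exist, form a Farey pair
  with that mediant, and such a pair is unique.\<close>

lemma farey_labelled_parents_pos:
  assumes "farey m n r s"
  shows "labelled_parents_pos (Fract (m + r) (n + s)) (slp m n, slp r s)"
proof -
  let ?t = "Fract (m + r) (n + s)"
  have pos: "n + s > 0" "m + r > 0"
    using farey_pos[OF assms] assms by (auto simp: farey_def)
  then have t: "?t > 0" by (simp add: zero_less_Fract_iff)
  then obtain u v where uv: "labelled_parents_pos ?t (u, v)"
    using labelled_parents_pos_ex1 by fast
  have "num (Frac ?t) = m + r" "den (Frac ?t) = n + s"
    using num_den_Fract[of "m + r" "n + s"] farey_coprime[OF farey_left[OF assms]] pos by auto
  with farey_unique[OF labelled_parents_pos_farey(1)[OF t uv] assms] labelled_parents_pos_farey(2,3)[OF t uv]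
  have "num u = m \<and> den u = n \<and> num v = r \<and> den v = s" by simp
  then have "u = slp m n" "v = slp r s" by (metis slp_num_den)+
  with uv show ?thesis by simp
qed

lemma slope_farey_right:
  assumes "x = Frac t" "t > 0"
  obtains m n r s where "farey m n r s" "x = slp (m + r) (n + s)"
proof -
  obtain u v where uv: "labelled_parents_pos t (u, v)"
    using labelled_parents_pos_ex1[OF assms(2)] by fast
  show thesis
    using that[OF labelled_parents_pos_farey(1)[OF assms(2) uv]] labelled_parents_pos_farey(2,3)[OF assms(2) uv]
      assms(1) slp_num_den[of x] by simp
qed

text \<open>The recursion in Farey coordinates. The value at 1/1 is prescribed separately in the
  scheme but obeys the same rule, which lets inductions start at the pair 0/1, 1/0.\<close>

lemma E_pos_child:
  assumes "farey m n r s"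
  shows "E_pos (slp (m + r) (n + s)) =
    (if odd ((m + r) * (n + s)) then E_pos (slp r s) \<otimes>\<^bsub>F2\<^esub> E_pos (slp m n)
     else E_pos (slp m n) \<otimes>\<^bsub>F2\<^esub> E_pos (slp r s))"
proof (cases "Fract (m + r) (n + s) = 1")
  case True
  have pos: "n + s > 0" using farey_pos[OF assms] assms by (auto simp: farey_def)
  have "m + r = 1" "n + s = 1"
    using num_den_Fract[of "m + r" "n + s"] farey_coprime[OF farey_left[OF assms]] pos True by auto
  then have "m = 0 \<and> n = 1 \<and> r = 1 \<and> s = 0"
    using farey_unique[OF assms farey_base] by simp
  then show ?thesis by (simp add: F2_simps inv_letter_def)
next
  case False
  let ?t = "Fract (m + r) (n + s)"
  have pos: "n + s > 0" "m + r > 0"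
    using farey_pos[OF assms] assms by (auto simp: farey_def)
  then have t: "?t > 0" by (simp add: zero_less_Fract_iff)
  have "(THE p. labelled_parents_pos ?t p) = (slp m n, slp r s)"
    using the1_equality[OF labelled_parents_pos_ex1[OF t] farey_labelled_parents_pos[OF assms]] .
  moreover have "num (Frac ?t) = m + r" "den (Frac ?t) = n + s"
    using num_den_Fract[of "m + r" "n + s"] farey_coprime[OF farey_left[OF assms]] pos by auto
  ultimately show ?thesis
    using t False pos by (simp add: slp_def[of "m + r"] del: num.simps den.simps)
qed

section \<open>The enumeration\<close>

text \<open>\<open>flip\<close> is the automorphism inverting \<open>A\<close>; it exchanges the positive and the negative scheme.\<close>

definition flip :: "word \<Rightarrow> word" where
  "flip w = map (\<lambda>(g, b). (g, (g = A) \<noteq> b)) w"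

lemma flip_simps [simp]:
  "flip [] = []" "flip ((g, b) # w) = (g, (g = A) \<noteq> b) # flip w"
  "length (flip w) = length w" "rev (flip w) = flip (rev w)" "flip (u @ v) = flip u @ flip v"
  by (auto simp: flip_def rev_map)

lemma flip_flip [simp]: "flip (flip w) = w"
  by (induction w) auto

lemma flip_push: "flip (push x w) = push (fst x, (fst x = A) \<noteq> snd x) (flip w)"
  by (cases x; cases w; cases "hd w") (auto simp: inv_letter_def)

lemma flip_mult: "flip (u \<otimes>\<^bsub>F2\<^esub> v) = flip u \<otimes>\<^bsub>F2\<^esub> flip v"
proof -
  have "flip (foldr push u v) = foldr push (flip u) (flip v)"
    by (induction u) (auto simp: flip_push)
  then show ?thesis by (simp add: F2_simps)
qed

lemma reduced_flip [simp]: "reduced (flip w) \<longleftrightarrow> reduced w"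
proof -
  have "reduced w \<Longrightarrow> reduced (flip w)" for w
    by (induction w rule: induct_list012) (auto simp: reduced_Cons inv_letter_def)
  from this[of w] this[of "flip w"] show ?thesis by auto
qed

lemma flip_hom: "flip \<in> hom F2 F2"
  by (auto simp: hom_def F2_simps(1) flip_mult)

interpretation flip: group_hom F2 F2 flip
  by unfold_locales (rule flip_hom)

lemma flip_image: "flip ` carrier F2 = carrier F2"
proof -
  have "w \<in> flip ` carrier F2" if "w \<in> carrier F2" for w
    using that by (intro image_eqI[of w flip "flip w"]) (auto simp: F2_simps(1))
  then show ?thesis by auto
qed

lemma esum_flip [simp]: "esum A (flip w) = - esum A w" "esum B (flip w) = esum B w"
  by (induction w) auto

lemma num_neg: "num (neg (Frac t)) = - num (Frac t)" and den_neg: "den (neg x) = den x"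
  by (cases x; simp add: rat_uminus_code split_def Let_def)+

lemma even_num_den_neg: "even (num (neg x) * den (neg x)) \<longleftrightarrow> even (num x * den x)"
  using num_neg by (cases x) (auto simp: den_neg simp del: num.simps den.simps neg.simps(1))

lemma E_neg_child:
  assumes "farey m n r s"
  shows "E_neg (neg (slp (m + r) (n + s))) =
    (if odd ((m + r) * (n + s)) then E_neg (neg (slp r s)) \<otimes>\<^bsub>F2\<^esub> E_neg (neg (slp m n))
     else E_neg (neg (slp m n)) \<otimes>\<^bsub>F2\<^esub> E_neg (neg (slp r s)))"
proof (cases "Fract (m + r) (n + s) = 1")
  case True
  have pos: "n + s > 0" using farey_pos[OF assms] assms by (auto simp: farey_def)
  have "m + r = 1" "n + s = 1"
    using num_den_Fract[of "m + r" "n + s"] farey_coprime[OF farey_left[OF assms]] pos True by auto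
  then have "m = 0 \<and> n = 1 \<and> r = 1 \<and> s = 0"
    using farey_unique[OF assms farey_base] by simp
  then show ?thesis by (simp add: F2_simps inv_letter_def)
next
  case False
  define t where "t = Fract (m + r) (n + s)"
  have pos: "n + s > 0" "m + r > 0"
    using farey_pos[OF assms] assms by (auto simp: farey_def)
  then have "0 < t" by (simp add: zero_less_Fract_iff t_def)
  then have t: "- t < 0" by simp
  have "labelled_parents_neg (- t) (neg (slp m n), neg (slp r s))"
    using farey_labelled_parents_pos[OF assms, folded t_def] by (simp add: labelled_parents_neg_iff[OF t])
  then have the: "(THE p. labelled_parents_neg (- t) p) = (neg (slp m n), neg (slp r s))"
    by (rule the1_equality[OF labelled_parents_neg_ex1[OF t]])
  have nd: "num (Frac t) = m + r" "den (Frac t) = n + s"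
    using num_den_Fract[of "m + r" "n + s"] farey_coprime[OF farey_left[OF assms]] pos
    by (auto simp: t_def)
  have "odd (num (Frac (- t)) * den (Frac (- t))) \<longleftrightarrow> odd ((m + r) * (n + s))"
    using even_num_den_neg[of "Frac t"] nd by (metis neg.simps(1))
  moreover have "- t \<noteq> - 1" using False unfolding t_def by (metis neg_equal_iff_equal)
  ultimately have "E_neg (Frac (- t)) =
    (if odd ((m + r) * (n + s)) then E_neg (neg (slp r s)) \<otimes>\<^bsub>F2\<^esub> E_neg (neg (slp m n))
     else E_neg (neg (slp m n)) \<otimes>\<^bsub>F2\<^esub> E_neg (neg (slp r s)))"
    using t by (simp add: the del: num.simps den.simps)
  then show ?thesis
    using pos by (simp add: slp_def[of "m + r"] t_def)
qed

text \<open>Both schemes follow the same recursion, and \<open>flip\<close> is a homomorphism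
  matching their initial words.\<close>

lemma E_neg_farey:
  assumes "farey m n r s"
  shows "E_neg (neg (slp m n)) = flip (E_pos (slp m n)) \<and> E_neg (neg (slp r s)) = flip (E_pos (slp r s))"
  using assms
proof (induction rule: farey_induct)
  case (left m n r s)
  then show ?case using E_neg_child[OF left(1)] E_pos_child[OF left(1)] by (simp add: flip_mult)
next
  case (right m n r s)
  then show ?case using E_neg_child[OF right(1)] E_pos_child[OF right(1)] by (simp add: flip_mult)
qed simp

text \<open>Neither of the two letters is inverse to the other, so these words multiply by
  concatenation and are cyclically reduced.\<close>

definition pos_word :: "word \<Rightarrow> bool" where
  "pos_word w \<longleftrightarrow> set w \<subseteq> {(A, False), (B, True)}"

lemma pos_word_append [simp]: "pos_word (u @ v) \<longleftrightarrow> pos_word u \<and> pos_word v"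
  by (auto simp: pos_word_def)

lemma pos_word_reduced: "pos_word w \<Longrightarrow> reduced w"
proof (induction w)
  case (Cons x w)
  then show ?case by (cases w) (auto simp: pos_word_def reduced_Cons inv_letter_def)
qed simp

lemma pos_word_mult: "pos_word u \<Longrightarrow> pos_word v \<Longrightarrow> u \<otimes>\<^bsub>F2\<^esub> v = u @ v"
  by (simp add: F2_mult_append pos_word_reduced)

lemma pos_word_cyclically_reduced: "pos_word w \<Longrightarrow> cyclically_reduced w"
  by (simp add: cyclically_reduced_iff pos_word_reduced)

lemma pos_word_length: "pos_word w \<Longrightarrow> int (length w) = esum B w - esum A w"
  by (induction w) (auto simp: pos_word_def)

lemma E_pos_farey_pos_word:
  assumes "farey m n r s"
  shows "pos_word (E_pos (slp m n)) \<and> pos_word (E_pos (slp r s))"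
  using assms
proof (induction rule: farey_induct)
  case base
  then show ?case by (simp add: pos_word_def)
next
  case (left m n r s)
  then show ?case by (auto simp: E_pos_child pos_word_mult)
next
  case (right m n r s)
  then show ?case by (auto simp: E_pos_child pos_word_mult)
qed

lemma E_pos_child_append:
  assumes "farey m n r s"
  shows "E_pos (slp (m + r) (n + s)) =
    (if odd ((m + r) * (n + s)) then E_pos (slp r s) @ E_pos (slp m n)
     else E_pos (slp m n) @ E_pos (slp r s))"
  using E_pos_farey_pos_word[OF assms] by (simp add: E_pos_child[OF assms] pos_word_mult)

lemma E_pos_farey_esum:
  assumes "farey m n r s"
  shows "esum A (E_pos (slp m n)) = - n \<and> esum B (E_pos (slp m n)) = m \<and>
    esum A (E_pos (slp r s)) = - s \<and> esum B (E_pos (slp r s)) = r"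
  using assms
proof (induction rule: farey_induct)
  case (left m n r s)
  then show ?case by (auto simp: E_pos_child_append)
next
  case (right m n r s)
  then show ?case by (auto simp: E_pos_child_append)
qed simp

text \<open>The clause on \<open>L @ R\<close> makes the invariant inductive. If \<open>L\<close> is
  odd, then \<open>R @ rev L = L @ R\<close>, and reversing \<open>L @ L @ R\<close> gives
  \<open>L @ R @ rev L\<close>, the same word. If both are even, the new odd word is
  \<open>R @ L\<close>, and \<open>L @ R @ L\<close> and \<open>R @ L @ R\<close> are
  palindromes.\<close>

lemma E_pos_farey_palindrome:
  assumes "farey m n r s"
  defines "L \<equiv> E_pos (slp m n)" and "R \<equiv> E_pos (slp r s)"
  shows "(even (m * n) \<longrightarrow> rev L = L) \<and> (even (r * s) \<longrightarrow> rev R = R) \<and>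
    (odd (m * n) \<or> odd (r * s) \<longrightarrow> rev (L @ R) = L @ R)"
  using assms(1) unfolding L_def R_def
proof (induction rule: farey_induct)
  case (left m n r s)
  from farey_parity[OF left(1)] left(2) show ?case
    unfolding E_pos_child_append[OF left(1)] by (elim disjE) auto
next
  case (right m n r s)
  from farey_parity[OF right(1)] right(2) show ?case
    unfolding E_pos_child_append[OF right(1)] by (elim disjE) auto
qed simp

lemma E_pos_farey_carrier:
  assumes "farey m n r s"
  shows "E_pos (slp m n) \<in> carrier F2" "E_pos (slp r s) \<in> carrier F2"
  using E_pos_farey_pos_word[OF assms] by (auto simp: F2_simps(1) pos_word_reduced)

lemma (in group) generate_mult_comm:
  assumes "x \<in> carrier G" "y \<in> carrier G" "generate G {x, y} = carrier G"
  shows "generate G {y \<otimes> x, y} = carrier G" "generate G {x, y \<otimes> x} = carrier G"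
  using generate_mult_right[of y x] generate_mult_left[of y x] assms by (simp_all add: insert_commute)

lemma E_pos_farey_generate:
  assumes "farey m n r s"
  shows "generate F2 {E_pos (slp m n), E_pos (slp r s)} = carrier F2"
  using assms
proof (induction rule: farey_induct)
  case base
  have "generate F2 {inv\<^bsub>F2\<^esub> [(A, True)], [(B, True)]} = carrier F2"
    by (rule F2.generate_inv_left[OF _ _ F2_generated]) (auto simp: F2_simps reduced_Cons)
  then show ?case by (simp add: F2_inverse)
next
  case (left m n r s)
  note c = E_pos_farey_carrier[OF left(1)]
  show ?case
    using F2.generate_mult_right[OF c left(2)] F2.generate_mult_comm(2)[OF c left(2)]
    by (simp add: E_pos_child[OF left(1)])
next
  case (right m n r s)
  note c = E_pos_farey_carrier[OF right(1)]
  show ?case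
    using F2.generate_mult_left[OF c right(2)] F2.generate_mult_comm(1)[OF c right(2)]
    by (simp add: E_pos_child[OF right(1)])
qed

section \<open>Reduction to the positive scheme\<close>

definition nonneg :: "slope \<Rightarrow> bool" where
  "nonneg x \<longleftrightarrow> num x \<ge> 0"

lemma nonneg_Frac: "nonneg (Frac t) \<longleftrightarrow> t \<ge> 0"
proof
  assume "nonneg (Frac t)"
  then show "t \<ge> 0"
    using num_den_Frac(1,2)[of t] unfolding nonneg_def
    by (metis divide_nonneg_pos of_int_0_le_iff of_int_0_less_iff)
qed (simp add: nonneg_def num_nonneg del: num.simps)

lemma nonneg_farey:
  assumes "nonneg x"
  obtains m n r s where "farey m n r s" "x = slp m n \<or> x = slp r s"
proof (cases x)
  case Infty
  then show thesis using that[OF farey_base] by simp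
next
  case (Frac t)
  then have "t \<ge> 0" using assms by (simp add: nonneg_Frac)
  then consider "t = 0" | "t > 0" by linarith
  then show thesis
  proof cases
    case 1
    then show thesis using that[OF farey_base] Frac by simp
  next
    case 2
    then show thesis using slope_farey_right[OF Frac] farey_left that by metis
  qed
qed

lemma farey_nonneg: "farey m n r s \<Longrightarrow> nonneg (slp m n) \<and> nonneg (slp r s)"
  using num_den_slp_farey(1,3) unfolding nonneg_def by (metis farey_def)

lemma E_cases:
  obtains (pos) "nonneg x" "E x = E_pos x" | (neg) "nonneg (neg x)" "E x = flip (E_pos (neg x))" "x \<noteq> Infty"
proof (cases x)
  case Infty
  then show thesis using pos by (simp add: E_def nonneg_def)
next
  case (Frac t)
  show thesis
  proof (cases "t \<ge> 0")
    case True
    then show thesis using pos Frac by (simp add: E_def nonneg_Frac)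
  next
    case False
    then have n: "nonneg (neg x)" using Frac by (simp add: nonneg_Frac)
    then obtain m n r s where "farey m n r s" "neg x = slp m n \<or> neg x = slp r s"
      by (rule nonneg_farey)
    then have "E_neg (neg (neg x)) = flip (E_pos (neg x))"
      using E_neg_farey by metis
    then show thesis using neg[OF n] Frac False by (simp add: E_def)
  qed
qed

text \<open>The inverse is needed at 0/1, where the two schemes agree only up to inversion.\<close>

lemma flip_E_pos:
  assumes "nonneg y"
  obtains x where "flip (E_pos y) = E x \<or> flip (E_pos y) = inv\<^bsub>F2\<^esub> (E x)"
proof (cases y)
  case Infty
  then show thesis using that[of Infty] by (simp add: E_def)
next
  case (Frac t)
  show thesis
  proof (cases "t = 0")
    case True
    then show thesis using that[of "Frac 0"] Frac
      by (simp add: E_def F2_inv reduced_Cons inv_letter_def)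
  next
    case False
    then have "\<not> nonneg (neg y)" using assms Frac by (simp add: nonneg_Frac)
    then show thesis
      using that[of "neg y"] E_cases[of "neg y"] by (metis neg_neg)
  qed
qed

lemma nonneg_E_pos:
  assumes "nonneg x"
  shows "pos_word (E_pos x)" "esum A (E_pos x) = - den x" "esum B (E_pos x) = num x"
    "even (num x * den x) \<Longrightarrow> rev (E_pos x) = E_pos x" "primitive_element (E_pos x)"
    "primitive_element (flip (E_pos x))"
proof -
  obtain m n r s where f: "farey m n r s" and x: "x = slp m n \<or> x = slp r s"
    using nonneg_farey[OF assms] .
  note nd = num_den_slp_farey[OF f]
  show "pos_word (E_pos x)" using x E_pos_farey_pos_word[OF f] by auto
  show "esum A (E_pos x) = - den x" "esum B (E_pos x) = num x"
    using x E_pos_farey_esum[OF f] nd by auto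
  show "even (num x * den x) \<Longrightarrow> rev (E_pos x) = E_pos x"
    using x E_pos_farey_palindrome[OF f] nd by auto
  note c = E_pos_farey_carrier[OF f] and g = E_pos_farey_generate[OF f]
  \<comment> \<open>The second generator is the word of a Farey neighbour.\<close>
  obtain y where y: "y \<in> carrier F2" "E_pos x \<in> carrier F2" "generate F2 {E_pos x, y} = carrier F2"
  proof (cases "x = slp m n")
    case True
    then show thesis using that[OF c(2)] c(1) g by simp
  next
    case False
    then have "x = slp r s" using x by simp
    then show thesis using that[OF c(1)] c(2) g insert_commute[of "E_pos (slp m n)" "E_pos (slp r s)" "{}"] by simp
  qed
  then show "primitive_element (E_pos x)"
    unfolding primitive_element_def by blast
  have "generate F2 {flip (E_pos x), flip y} = carrier F2"
    using flip.generate_img[of "{E_pos x, y}"] y flip_image by simp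
  then show "primitive_element (flip (E_pos x))"
    unfolding primitive_element_def using y flip.hom_closed by blast
qed

lemma primitive_E: "primitive_element (E x)"
  by (rule E_cases[of x]) (use nonneg_E_pos in auto)

lemma esum_E:
  obtains e :: int where "e = 1 \<or> e = - 1" "esum A (E x) = e * den x" "esum B (E x) = - e * num x"
proof (cases rule: E_cases[of x])
  case pos
  then show thesis using that[of "- 1"] nonneg_E_pos(2,3)[of x] by simp
next
  case neg
  then obtain t where "x = Frac t" by (cases x) auto
  then have "num (neg x) = - num x" "den (neg x) = den x"
    using num_neg den_neg by metis+
  then show thesis using that[of 1] nonneg_E_pos(2,3)[of "neg x"] neg by simp
qed

lemma slope_eqI: "num x = num y \<Longrightarrow> den x = den y \<Longrightarrow> x = y"
  by (metis slp_num_den)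

section \<open>The enumeration up to conjugacy and inversion\<close>

lemma E_conj_unique:
  assumes "conjugate_in_F2 W (E x) \<or> conjugate_in_F2 W (inv\<^bsub>F2\<^esub> (E x))"
    "conjugate_in_F2 W (E y) \<or> conjugate_in_F2 W (inv\<^bsub>F2\<^esub> (E y))"
  shows "x = y"
proof -
  have *: "\<exists>e. (e = 1 \<or> e = - 1) \<and> esum A W = e * den x \<and> esum B W = - e * num x"
    if "conjugate_in_F2 W (E x) \<or> conjugate_in_F2 W (inv\<^bsub>F2\<^esub> (E x))" for x
  proof -
    obtain e where e: "e = 1 \<or> e = - 1" "esum A (E x) = e * den x" "esum B (E x) = - e * num x"
      using esum_E .
    have "reduced (E x)" using primitive_E[of x] by (simp add: primitive_element_def F2_simps(1))
    then have "(esum A W = esum A (E x) \<and> esum B W = esum B (E x)) \<or>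
        (esum A W = - esum A (E x) \<and> esum B W = - esum B (E x))"
      using that esum_conj[of W "E x"] esum_conj[of W "winv (E x)"] by (auto simp: F2_inv)
    then show ?thesis
      using e by (intro exI[of _ "if esum A W = esum A (E x) \<and> esum B W = esum B (E x) then e else - e"]) auto
  qed
  from *[OF assms(1)] *[OF assms(2)] have
    "den x = den y \<and> num x = num y \<or> den x = - den y \<and> num x = - num y"
    by auto
  then show ?thesis
  proof
    assume "den x = - den y \<and> num x = - num y"
    \<comment> \<open>Denominators are nonnegative, so opposite signs are possible only at
      1/0.\<close>
    then have "den x = 0" "den y = 0" using den_nonneg[of x] den_nonneg[of y] by auto
    moreover have "z = Infty" if "den z = 0" for z
      using num_den_Frac(1) that by (metis less_irrefl slope.exhaust)
    ultimately show ?thesis by metis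
  qed (simp add: slope_eqI)
qed

lemma pos_pair_farey:
  assumes "F2.pos_pair [(A, False)] [(B, True)] X Y"
  shows "\<exists>m n r s. \<exists>g \<in> carrier F2. farey m n r s \<and>
    X = g \<otimes>\<^bsub>F2\<^esub> E_pos (slp m n) \<otimes>\<^bsub>F2\<^esub> inv\<^bsub>F2\<^esub> g \<and>
    Y = g \<otimes>\<^bsub>F2\<^esub> E_pos (slp r s) \<otimes>\<^bsub>F2\<^esub> inv\<^bsub>F2\<^esub> g"
  using assms
proof induction
  case base
  have "[] \<in> carrier F2" "[(A, False)] = [] \<otimes>\<^bsub>F2\<^esub> E_pos (slp 0 1) \<otimes>\<^bsub>F2\<^esub> inv\<^bsub>F2\<^esub> []"
    "[(B, True)] = [] \<otimes>\<^bsub>F2\<^esub> E_pos (slp 1 0) \<otimes>\<^bsub>F2\<^esub> inv\<^bsub>F2\<^esub> []"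
    by (simp_all add: F2_inv F2_simps)
  then show ?case using farey_base by blast
next
  case (left x y)
  then obtain m n r s g where g: "g \<in> carrier F2" and f: "farey m n r s"
    and x: "x = g \<otimes>\<^bsub>F2\<^esub> E_pos (slp m n) \<otimes>\<^bsub>F2\<^esub> inv\<^bsub>F2\<^esub> g"
    and y: "y = g \<otimes>\<^bsub>F2\<^esub> E_pos (slp r s) \<otimes>\<^bsub>F2\<^esub> inv\<^bsub>F2\<^esub> g" by blast
  note c = E_pos_farey_carrier[OF f]
  \<comment> \<open>At odd type the scheme multiplies in the opposite order. Conjugation by the word
    that is kept restores the order without moving that word.\<close>
  define h where "h = (if odd ((m + r) * (n + s)) then g \<otimes>\<^bsub>F2\<^esub> inv\<^bsub>F2\<^esub> (E_pos (slp r s)) else g)"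
  have "h \<in> carrier F2" using g c by (simp add: h_def)
  moreover have "x \<otimes>\<^bsub>F2\<^esub> y = h \<otimes>\<^bsub>F2\<^esub> E_pos (slp (m + r) (n + s)) \<otimes>\<^bsub>F2\<^esub> inv\<^bsub>F2\<^esub> h"
    "y = h \<otimes>\<^bsub>F2\<^esub> E_pos (slp r s) \<otimes>\<^bsub>F2\<^esub> inv\<^bsub>F2\<^esub> h"
    using g c by (simp_all add: x y h_def E_pos_child[OF f] F2.m_assoc F2.inv_mult_group)
  ultimately show ?case using farey_right[OF f] by blast
next
  case (right x y)
  then obtain m n r s g where g: "g \<in> carrier F2" and f: "farey m n r s"
    and x: "x = g \<otimes>\<^bsub>F2\<^esub> E_pos (slp m n) \<otimes>\<^bsub>F2\<^esub> inv\<^bsub>F2\<^esub> g"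
    and y: "y = g \<otimes>\<^bsub>F2\<^esub> E_pos (slp r s) \<otimes>\<^bsub>F2\<^esub> inv\<^bsub>F2\<^esub> g" by blast
  note c = E_pos_farey_carrier[OF f]
  \<comment> \<open>Here the left word is kept, so it is the one to conjugate by.\<close>
  define h where "h = (if odd ((m + r) * (n + s)) then g \<otimes>\<^bsub>F2\<^esub> E_pos (slp m n) else g)"
  have "h \<in> carrier F2" using g c by (simp add: h_def)
  moreover have "x \<otimes>\<^bsub>F2\<^esub> y = h \<otimes>\<^bsub>F2\<^esub> E_pos (slp (m + r) (n + s)) \<otimes>\<^bsub>F2\<^esub> inv\<^bsub>F2\<^esub> h"
    "x = h \<otimes>\<^bsub>F2\<^esub> E_pos (slp m n) \<otimes>\<^bsub>F2\<^esub> inv\<^bsub>F2\<^esub> h"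
    using g c by (simp_all add: x y h_def E_pos_child[OF f] F2.m_assoc F2.inv_mult_group)
  ultimately show ?case using farey_left[OF f] by blast
next
  case (conj x y k)
  then obtain m n r s g where g: "g \<in> carrier F2" and f: "farey m n r s"
    and x: "x = g \<otimes>\<^bsub>F2\<^esub> E_pos (slp m n) \<otimes>\<^bsub>F2\<^esub> inv\<^bsub>F2\<^esub> g"
    and y: "y = g \<otimes>\<^bsub>F2\<^esub> E_pos (slp r s) \<otimes>\<^bsub>F2\<^esub> inv\<^bsub>F2\<^esub> g" by blast
  note c = E_pos_farey_carrier[OF f]
  define h where "h = k \<otimes>\<^bsub>F2\<^esub> g"
  have "h \<in> carrier F2" using g conj.hyps by (simp add: h_def)
  moreover have "k \<otimes>\<^bsub>F2\<^esub> x \<otimes>\<^bsub>F2\<^esub> inv\<^bsub>F2\<^esub> k = h \<otimes>\<^bsub>F2\<^esub> E_pos (slp m n) \<otimes>\<^bsub>F2\<^esub> inv\<^bsub>F2\<^esub> h"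
    "k \<otimes>\<^bsub>F2\<^esub> y \<otimes>\<^bsub>F2\<^esub> inv\<^bsub>F2\<^esub> k = h \<otimes>\<^bsub>F2\<^esub> E_pos (slp r s) \<otimes>\<^bsub>F2\<^esub> inv\<^bsub>F2\<^esub> h"
    using g c conj.hyps by (simp_all add: x y h_def F2.m_assoc F2.inv_mult_group)
  ultimately show ?case using f by blast
qed

lemma pos_pair_flip:
  assumes "F2.pos_pair [(A, True)] [(B, True)] X Y"
  shows "F2.pos_pair [(A, False)] [(B, True)] (flip X) (flip Y)"
  using assms
proof induction
  case base
  then show ?case using F2.pos_pair.base[of "[(A, False)]" "[(B, True)]"] by simp
next
  case (left x y)
  then show ?case by (auto simp: flip_mult intro: F2.pos_pair.left)
next
  case (right x y)
  then show ?case by (auto simp: flip_mult intro: F2.pos_pair.right)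
next
  case (conj x y g)
  then show ?case
    using F2.pos_pair.conj[OF conj.IH, of "flip g"] by (simp add: flip_mult)
qed

lemma pos_pair_conj_E:
  assumes "F2.pos_pair a [(B, True)] X Y" "a \<in> {[(A, True)], [(A, False)]}" "W = X \<or> W = Y"
  shows "\<exists>g \<in> carrier F2. \<exists>x. \<exists>U \<in> {E x, inv\<^bsub>F2\<^esub> (E x)}. W = g \<otimes>\<^bsub>F2\<^esub> U \<otimes>\<^bsub>F2\<^esub> inv\<^bsub>F2\<^esub> g"
proof (cases "a = [(A, True)]")
  case True
  then obtain m n r s g where g: "g \<in> carrier F2" and f: "farey m n r s"
    and XY: "flip X = g \<otimes>\<^bsub>F2\<^esub> E_pos (slp m n) \<otimes>\<^bsub>F2\<^esub> inv\<^bsub>F2\<^esub> g"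
      "flip Y = g \<otimes>\<^bsub>F2\<^esub> E_pos (slp r s) \<otimes>\<^bsub>F2\<^esub> inv\<^bsub>F2\<^esub> g"
    using pos_pair_farey[OF pos_pair_flip] assms(1) by blast
  obtain z where z: "nonneg z" "flip W = g \<otimes>\<^bsub>F2\<^esub> E_pos z \<otimes>\<^bsub>F2\<^esub> inv\<^bsub>F2\<^esub> g"
    using XY assms(3) farey_nonneg[OF f] by blast
  then have "W = flip (g \<otimes>\<^bsub>F2\<^esub> E_pos z \<otimes>\<^bsub>F2\<^esub> inv\<^bsub>F2\<^esub> g)" by (metis flip_flip)
  then have "W = flip g \<otimes>\<^bsub>F2\<^esub> flip (E_pos z) \<otimes>\<^bsub>F2\<^esub> inv\<^bsub>F2\<^esub> (flip g)"
    using g by (simp add: flip_mult)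
  moreover have "flip g \<in> carrier F2" using g by simp
  ultimately show ?thesis using flip_E_pos[OF z(1)] by (metis insertCI)
next
  case False
  then obtain m n r s g where g: "g \<in> carrier F2" and f: "farey m n r s"
    and XY: "X = g \<otimes>\<^bsub>F2\<^esub> E_pos (slp m n) \<otimes>\<^bsub>F2\<^esub> inv\<^bsub>F2\<^esub> g"
      "Y = g \<otimes>\<^bsub>F2\<^esub> E_pos (slp r s) \<otimes>\<^bsub>F2\<^esub> inv\<^bsub>F2\<^esub> g"
    using pos_pair_farey assms(1,2) by blast
  obtain z where z: "nonneg z" "W = g \<otimes>\<^bsub>F2\<^esub> E_pos z \<otimes>\<^bsub>F2\<^esub> inv\<^bsub>F2\<^esub> g"
    using XY assms(3) farey_nonneg[OF f] by blast
  have "E z = E_pos z"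
    using z(1) nonneg_Frac by (cases z) (auto simp: E_def)
  with z g show ?thesis by (metis insertCI)
qed

lemma primitive_conj_E:
  assumes "primitive_element W"
  shows "\<exists>x. conjugate_in_F2 W (E x) \<or> conjugate_in_F2 W (inv\<^bsub>F2\<^esub> (E x))"
proof -
  obtain V where V: "W \<in> carrier F2" "V \<in> carrier F2" "generate F2 {W, V} = carrier F2"
    using assms by (auto simp: primitive_element_def)
  then have "nielsen W V" by (intro generating_pair_nielsen) (auto simp: F2_simps(1))
  moreover have "[(A, True)] \<in> carrier F2" "[(B, True)] \<in> carrier F2" "inv\<^bsub>F2\<^esub> [(A, True)] = [(A, False)]"
    by (auto simp: F2_simps(1) reduced_Cons F2_inverse)
  ultimately have "F2.signed_pair [(A, True)] [(B, True)] W V" "inv\<^bsub>F2\<^esub> [(A, True)] = [(A, False)]"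
    using F2.nielsen_equiv_signed_pair by blast+
  then obtain a W' V' where a: "a \<in> {[(A, True)], [(A, False)]}" and W': "W' \<in> {W, inv\<^bsub>F2\<^esub> W}"
    and "F2.pos_pair a [(B, True)] W' V' \<or> F2.pos_pair a [(B, True)] V' W'"
    unfolding F2.signed_pair_def by auto
  then obtain X Y where "F2.pos_pair a [(B, True)] X Y" "W' = X \<or> W' = Y" by blast
  from pos_pair_conj_E[OF this(1) a this(2)] obtain g x U where
    g: "g \<in> carrier F2" and U: "U \<in> {E x, inv\<^bsub>F2\<^esub> (E x)}"
    and "W' = g \<otimes>\<^bsub>F2\<^esub> U \<otimes>\<^bsub>F2\<^esub> inv\<^bsub>F2\<^esub> g" by blast
  moreover have E: "E x \<in> carrier F2" using primitive_E by (simp add: primitive_element_def)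
  ultimately have "U = inv\<^bsub>F2\<^esub> g \<otimes>\<^bsub>F2\<^esub> W' \<otimes>\<^bsub>F2\<^esub> inv\<^bsub>F2\<^esub> (inv\<^bsub>F2\<^esub> g)"
    by (auto simp: F2.m_assoc)
  then have "U = inv\<^bsub>F2\<^esub> g \<otimes>\<^bsub>F2\<^esub> W \<otimes>\<^bsub>F2\<^esub> inv\<^bsub>F2\<^esub> (inv\<^bsub>F2\<^esub> g) \<or>
      inv\<^bsub>F2\<^esub> U = inv\<^bsub>F2\<^esub> g \<otimes>\<^bsub>F2\<^esub> W \<otimes>\<^bsub>F2\<^esub> inv\<^bsub>F2\<^esub> (inv\<^bsub>F2\<^esub> g)"
    using W' V(1) g by (auto simp: F2.m_assoc F2.inv_mult_group)
  then have "conjugate_in_F2 W U \<or> conjugate_in_F2 W (inv\<^bsub>F2\<^esub> U)"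
    unfolding conjugate_in_F2_def using F2.inv_closed[OF g] by blast
  then show ?thesis using U E by auto
qed

section \<open>Palindromes in the enumeration\<close>

lemma cyclically_reduced_flip [simp]: "cyclically_reduced (flip w) \<longleftrightarrow> cyclically_reduced w"
  using reduced_flip[of "w @ w"] by (simp add: cyclically_reduced_iff del: reduced_flip)

lemma palindrome_flip [simp]: "palindrome (flip w) \<longleftrightarrow> palindrome w"
  by (simp add: palindrome_def F2_simps(1)) (metis flip_flip)

lemma cyclically_reduced_E: "cyclically_reduced (E x)"
  by (rule E_cases[of x]) (use nonneg_E_pos(1) pos_word_cyclically_reduced in auto)

lemma num_den_coprime: "coprime (num x) (den x)"
  using num_den_Frac(3) by (cases x) auto

text \<open>The word at \<open>p/q\<close> has length \<open>p + q\<close>. If \<open>p q\<close> is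
  even, coprimality leaves exactly one of \<open>p\<close> and \<open>q\<close> even, so the length
  is odd, as uniqueness among rotations demands.\<close>

lemma palindrome_E_pos:
  "nonneg x \<Longrightarrow> even (num x * den x) \<Longrightarrow> palindrome (E_pos x) \<and> odd (length (E_pos x))"
proof -
  assume x: "nonneg x" "even (num x * den x)"
  have "odd (num x + den x)"
    using x(2) num_den_coprime[of x] by (auto dest: coprime_common_divisor[of _ _ 2])
  moreover have "int (length (E_pos x)) = num x + den x"
    using nonneg_E_pos(1-3)[OF x(1)] by (simp add: pos_word_length)
  ultimately have "odd (int (length (E_pos x)))" by simp
  then show ?thesis
    using nonneg_E_pos(1,4)[OF x(1)] x(2) by (auto simp: palindrome_def F2_simps(1) pos_word_reduced)
qed

lemma palindrome_E:
  assumes "even (num x * den x)"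
  shows "palindrome (E x)" "odd (length (E x))"
  using palindrome_E_pos[of x] palindrome_E_pos[of "neg x"] assms even_num_den_neg[of x]
  by (cases rule: E_cases[of x]; simp)+

text \<open>An odd mediant forces both parents to be of even type, so their words are
  palindromes.\<close>

lemma odd_farey_children:
  assumes "r > 0" "odd (num (Frac r) * den (Frac r))" "labelled_parents_pos r (u, v)"
  shows "farey (num u) (den u) (num v) (den v)" "E_pos (Frac r) = E_pos v \<otimes>\<^bsub>F2\<^esub> E_pos u"
    "palindrome (E_pos u)" "palindrome (E_pos v)" "even (num u * den u)" "even (num v * den v)"
proof -
  note f = labelled_parents_pos_farey[OF assms(1,3)]
  show "farey (num u) (den u) (num v) (den v)" by (rule f)
  have "Frac r = slp (num u + num v) (den u + den v)"
    unfolding f(2,3) by (rule slp_num_den[symmetric])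
  then show "E_pos (Frac r) = E_pos v \<otimes>\<^bsub>F2\<^esub> E_pos u"
    using E_pos_child[OF f(1)] assms(2) f(2,3) by simp
  have e: "even (num u * den u)" "even (num v * den v)"
    using farey_parity[OF f(1)] assms(2) f(2,3) by auto
  then show "even (num u * den u)" "even (num v * den v)" by auto
  have "nonneg u" "nonneg v" using f(1) by (auto simp: nonneg_def farey_def)
  with e palindrome_E_pos show "palindrome (E_pos u)" "palindrome (E_pos v)" by blast+
qed

theorem theorem2p1:
  shows "(\<forall>x. primitive_element (E x)) \<and>
    (\<forall>W. primitive_element W \<longrightarrow>
       (\<exists>!x. conjugate_in_F2 W (E x) \<or> conjugate_in_F2 W (inv\<^bsub>F2\<^esub> (E x)))) \<and>
    (\<forall>x. even (num x * den x) \<longrightarrow>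
       palindrome (E x) \<and> cyclically_reduced (E x) \<and>
       (\<forall>W. palindrome W \<and> conjugate_in_F2 W (E x) \<longrightarrow> W = E x)) \<and>
    (\<forall>r > 0. odd (num (Frac r) * den (Frac r)) \<longrightarrow>
       (\<forall>u v. labelled_parents_pos r (u, v) \<longrightarrow>
          E (Frac r) = E_pos v \<otimes>\<^bsub>F2\<^esub> E_pos u \<and>
          palindrome (E_pos u) \<and> palindrome (E_pos v) \<and>
          even (num u * den u) \<and> even (num v * den v)) \<and>
       cyclically_reduced (E (Frac r))) \<and>
    (\<forall>r < 0. odd (num (Frac r) * den (Frac r)) \<longrightarrow>
       (\<forall>u v. labelled_parents_neg r (u, v) \<longrightarrow>
          E (Frac r) = E_neg v \<otimes>\<^bsub>F2\<^esub> E_neg u \<and>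
          palindrome (E_neg u) \<and> palindrome (E_neg v) \<and>
          even (num u * den u) \<and> even (num v * den v)) \<and>
       cyclically_reduced (E (Frac r)))"
proof (intro conjI allI impI; (elim conjE)?)
  fix W assume "primitive_element W"
  then show "\<exists>!x. conjugate_in_F2 W (E x) \<or> conjugate_in_F2 W (inv\<^bsub>F2\<^esub> (E x))"
    using primitive_conj_E E_conj_unique by metis
next
  fix x W assume "even (num x * den x)" "palindrome W" "conjugate_in_F2 W (E x)"
  then show "W = E x" using palindrome_conj_unique palindrome_E by blast
next
  fix r :: rat and u v
  assume r: "r > 0" "odd (num (Frac r) * den (Frac r))" "labelled_parents_pos r (u, v)"
  note * = odd_farey_children[OF r]
  then show "E (Frac r) = E_pos v \<otimes>\<^bsub>F2\<^esub> E_pos u" using r(1) by (simp add: E_def)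
  show "palindrome (E_pos u)" "palindrome (E_pos v)" "even (num u * den u)" "even (num v * den v)"
    by (rule *)+
next
  fix r :: rat and u v
  assume r: "r < 0" "odd (num (Frac r) * den (Frac r))" "labelled_parents_neg r (u, v)"
  \<comment> \<open>Negation exchanges the two labellings and keeps parity; \<open>flip\<close> then
    carries the positive result over.\<close>
  have r': "- r > 0" "odd (num (Frac (- r)) * den (Frac (- r)))" "labelled_parents_pos (- r) (neg u, neg v)"
    using r even_num_den_neg[of "Frac r"] by (simp_all add: labelled_parents_neg_iff del: num.simps den.simps)
  note * = odd_farey_children[OF r']
  have uv: "E_neg u = flip (E_pos (neg u))" "E_neg v = flip (E_pos (neg v))"
    using E_neg_farey[OF *(1)] by simp_all
  have "E (Frac r) = flip (E_pos (Frac (- r)))"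
    using r(1) E_cases[of "Frac r"] by (metis neg.simps(1) nonneg_Frac not_le)
  then show "E (Frac r) = E_neg v \<otimes>\<^bsub>F2\<^esub> E_neg u"
    unfolding uv *(2) by (simp add: flip_mult)
  show "palindrome (E_neg u)" "palindrome (E_neg v)" using *(3,4) by (simp_all add: uv)
  show "even (num u * den u)" "even (num v * den v)" using *(5,6) unfolding even_num_den_neg .
qed (auto simp: primitive_E palindrome_E cyclically_reduced_E)

end
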